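(* Consider the Poisson $i\mathcal{S}$-graph with legitimate-node density $\lambda_\ell>0$, eavesdropper density $\lambda_{\mathrm e}>0$, secrecy rate threshold zero, equal noise powers, and random propagation effects $Z_{x_i,x_j}$ whose probability density function is a continuous function $f_Z(z)$. Then the probability mass function of the out-degree $N_{\mathrm{out}}$ of a typical node is $$p_{N_{\mathrm{out}}}(n)=\left(\frac{\lambda_\ell}{\lambda_\ell+\lambda_{\mathrm e}}\right)^{n}\left(\frac{\lambda_{\mathrm e}}{\lambda_\ell+\lambda_{\mathrm e}}\right),\qquad n\ge 0,$$ and in particular it is invariant with respect to $f_Z$.
   Context: $\Pi_\ell$ (legitimate nodes) and $\Pi_{\mathrm e}$ (eavesdroppers) are mutually independent homogeneous Poisson point processes on $\mathbb{R}^2$ with densities $\lambda_\ell>0$, $\lambda_{\mathrm e}>0$. To each pair of distinct points $u,v$ (legitimate node–legitimate node or legitimate node–eavesdropper) is attached a positive random variable $Z_{u,v}=Z_{v,u}$; these variables are i.i.d. over unordered pairs with density $f_Z$, and independent of $\Pi_\ell,\Pi_{\mathrm e}$. The power gain of the link $\overrightarrow{uv}$ is $g(|u-v|,Z_{u,v})$, where $g(r,z)>0$ is continuous and strictly decreasing in $r$, with $\lim_{r\to\infty}g(r,z)=0$. $i\mathcal{S}$-graph with zero threshold and equal noise powers: the directed graph on the legitimate nodes with edge $\overrightarrow{xy}$ if and only if the maximum secrecy rate of the link is positive, which in this setting is equivalent to $$g(|x-y|,Z_{x,y})>g(|x-e^*|,Z_{x,e^*}),\qquad e^*=\operatorname*{argmax}_{e\in\Pi_{\mathrm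 e}} g(|x-e|,Z_{x,e}).$$ As implicit in this definition, the maximizer $e^*$ is assumed to exist almost surely. Typical node: the node at the origin when the graph is built on the legitimate-node set $\Pi_\ell\cup\{0\}$ with eavesdroppers $\Pi_{\mathrm e}$. Its out-degree $N_{\mathrm{out}}$ is the number of $x\in\Pi_\ell$ with an edge $\overrightarrow{0x}$. *)

theory Defs
  imports "HOL-Probability.Probability" "HOL-Library.Extended_Nat"
begin

type_synonym plane = "real ^ 2"

section \<open>Poisson point processes in the plane\<close>

text \<open>
  A (simple) point process is a random locally finite set of points, i.e. a measurable map into
  the space of configurations, whose sigma-algebra is generated by the counts in bounded
  Borel sets.
\<close>

definition configs :: "plane set set" where
  "configs = {\<phi>. \<forall>B. bounded B \<longrightarrow> finite (\<phi> \<inter> B)}"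

definition config_space :: "plane set measure" where
  "config_space =
     sigma configs {{\<phi> \<in> configs. card (\<phi> \<inter> B) = k} | B k. B \<in> sets borel \<and> bounded B}"

definition poisson_process :: "'w measure \<Rightarrow> real \<Rightarrow> ('w \<Rightarrow> plane set) \<Rightarrow> bool" where
  "poisson_process M lam \<Phi> \<longleftrightarrow>
     \<Phi> \<in> measurable M config_space \<and>
     (\<forall>B k. B \<in> sets borel \<longrightarrow> bounded B \<longrightarrow>
        measure M {\<omega> \<in> space M. card (\<Phi> \<omega> \<inter> B) = k} =
          (lam * measure lborel B) ^ k / fact k * exp (- (lam * measure lborel B))) \<and>
     (\<forall>(B :: nat \<Rightarrow> plane set) n.
        (\<forall>i<n. B i \<in> sets borel \<and> bounded (B i)) \<longrightarrow> disjoint_family_on B {..<n} \<longrightarrow>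
        prob_space.indep_vars M (\<lambda>_. count_space UNIV) (\<lambda>i \<omega>. card (\<Phi> \<omega> \<inter> B i)) {..<n})"

section \<open>Propagation effects\<close>

text \<open>
  \<open>Z \<omega> u v\<close> is the propagation effect between the points \<open>u\<close> and \<open>v\<close>. As usual for marks of
  point processes, an i.i.d. family attached to pairs of random points is made
  precise through a measurable enumeration of the points.  Here \<open>L\<close> and \<open>E\<close> enumerate the
  legitimate nodes and the eavesdroppers.  One variable belongs to each unordered pair of
  legitimate nodes, labelled \<open>Inl (i, j)\<close> with \<open>i < j\<close>, and one to each pair of a legitimate node
  and an eavesdropper, labelled \<open>Inr (i, j)\<close>.
\<close>

definition links :: "(nat \<times> nat + nat \<times> nat) set" where
  "links = Inl ` {(i, j). i < j} \<union> range Inr"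

definition link_effect ::
    "('w \<Rightarrow> plane \<Rightarrow> plane \<Rightarrow> real) \<Rightarrow> (nat \<Rightarrow> 'w \<Rightarrow> plane) \<Rightarrow> (nat \<Rightarrow> 'w \<Rightarrow> plane) \<Rightarrow>
     nat \<times> nat + nat \<times> nat \<Rightarrow> 'w \<Rightarrow> real" where
  "link_effect Z L E k \<omega> =
     (case k of Inl (i, j) \<Rightarrow> Z \<omega> (L i \<omega>) (L j \<omega>) | Inr (i, j) \<Rightarrow> Z \<omega> (L i \<omega>) (E j \<omega>))"

text \<open>
  The variables are required to be independent of the enumerations and not only of
  the random sets \<open>V\<close> and \<open>W\<close>: otherwise the order of the points could carry information
  about the variables.  Since \<open>V\<close> and \<open>W\<close> are almost surely determined by \<open>L\<close> and \<open>E\<close>,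
  independence of \<open>V\<close> and \<open>W\<close> is a consequence.  It is stated for the generated sigma-algebras
  because \<^const>\<open>prob_space.indep_var\<close> needs both variables to have the same type.
\<close>

definition iid_propagation ::
    "'w measure \<Rightarrow> ('w \<Rightarrow> plane set) \<Rightarrow> ('w \<Rightarrow> plane set) \<Rightarrow> (real \<Rightarrow> real) \<Rightarrow>
     ('w \<Rightarrow> plane \<Rightarrow> plane \<Rightarrow> real) \<Rightarrow> bool" where
  "iid_propagation M V W f Z \<longleftrightarrow>
     (AE \<omega> in M. \<forall>u \<in> V \<omega>. \<forall>v \<in> V \<omega> \<union> W \<omega>. u \<noteq> v \<longrightarrow> Z \<omega> u v = Z \<omega> v u \<and> 0 < Z \<omega> u v) \<and>
     (\<exists>L E.
        (\<forall>i. L i \<in> borel_measurable M) \<and> (\<forall>j. E j \<in> borel_measurable M) \<and>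
        (AE \<omega> in M. bij_betw (\<lambda>i. L i \<omega>) UNIV (V \<omega>) \<and> bij_betw (\<lambda>j. E j \<omega>) UNIV (W \<omega>)) \<and>
        (\<forall>k \<in> links. distributed M lborel (link_effect Z L E k) (\<lambda>z. ennreal (f z))) \<and>
        prob_space.indep_vars M (\<lambda>_. borel) (link_effect Z L E) links \<and>
        prob_space.indep_set M
          (sets (vimage_algebra (space M) (\<lambda>\<omega>. ((\<lambda>i. L i \<omega>), (\<lambda>j. E j \<omega>)))
             (PiM UNIV (\<lambda>_. borel) \<Otimes>\<^sub>M PiM UNIV (\<lambda>_. borel))))
          (sets (vimage_algebra (space M) (\<lambda>\<omega>. \<lambda>k\<in>links. link_effect Z L E k \<omega>)
             (PiM links (\<lambda>_. borel)))))"

section \<open>The intrinsically secure graph\<close>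

text \<open>
  \<open>P\<close> is the transmit power, \<open>g\<close> the power gain as a function of the distance and of
  the propagation effect, \<open>z\<close> a realisation of the propagation effects, and \<open>nl\<close>, \<open>ne\<close> the noise
  powers of the legitimate nodes and of the eavesdroppers.
\<close>

definition rx_power ::
    "real \<Rightarrow> (real \<Rightarrow> real \<Rightarrow> real) \<Rightarrow> (plane \<Rightarrow> plane \<Rightarrow> real) \<Rightarrow> plane \<Rightarrow> plane \<Rightarrow> real" where
  "rx_power P g z x y = P * g (dist x y) (z x y)"

definition strongest_eavesdropper ::
    "real \<Rightarrow> (real \<Rightarrow> real \<Rightarrow> real) \<Rightarrow> (plane \<Rightarrow> plane \<Rightarrow> real) \<Rightarrow> plane set \<Rightarrow> plane \<Rightarrow> plane \<Rightarrow> bool"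
  where
  "strongest_eavesdropper P g z W x e \<longleftrightarrow> is_arg_max (rx_power P g z x) (\<lambda>e. e \<in> W) e"

text \<open>
  Maximum secrecy rate of the Gaussian wiretap channel from \<open>x\<close> to \<open>y\<close> with
  eavesdropper \<open>e\<close>: the positive part of the difference of the two channel capacities.
\<close>

definition secrecy_rate ::
    "real \<Rightarrow> real \<Rightarrow> real \<Rightarrow> (real \<Rightarrow> real \<Rightarrow> real) \<Rightarrow> (plane \<Rightarrow> plane \<Rightarrow> real) \<Rightarrow>
     plane \<Rightarrow> plane \<Rightarrow> plane \<Rightarrow> real" where
  "secrecy_rate P nl ne g z x y e =
     max 0 (log 2 (1 + rx_power P g z x y / nl) - log 2 (1 + rx_power P g z x e / ne))"

text \<open>
  Edge set of the graph on the legitimate nodes \<open>V\<close> with eavesdroppers \<open>W\<close> and secrecy rate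
  threshold \<open>\<rho>\<close>.  The rate depends on the maximiser only through the maximal power, so the
  choice of the maximiser is immaterial.
\<close>

definition iS_graph ::
    "real \<Rightarrow> real \<Rightarrow> real \<Rightarrow> real \<Rightarrow> (real \<Rightarrow> real \<Rightarrow> real) \<Rightarrow> (plane \<Rightarrow> plane \<Rightarrow> real) \<Rightarrow>
     plane set \<Rightarrow> plane set \<Rightarrow> (plane \<times> plane) set" where
  "iS_graph P nl ne \<rho> g z V W =
     {(x, y). x \<in> V \<and> y \<in> V \<and> x \<noteq> y \<and>
        (\<exists>e. strongest_eavesdropper P g z W x e \<and> \<rho> < secrecy_rate P nl ne g z x y e)}"

definition out_degree :: "('a \<times> 'a) set \<Rightarrow> 'a \<Rightarrow> enat" where
  "out_degree G x = (if finite (G `` {x}) then enat (card (G `` {x})) else \<infinity>)"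

lemma strongest_eavesdropper_iff:
  assumes "0 < P"
  shows "strongest_eavesdropper P g z W x e \<longleftrightarrow>
           is_arg_max (\<lambda>e. g (dist x e) (z x e)) (\<lambda>e. e \<in> W) e"
  using assms by (auto simp: strongest_eavesdropper_def is_arg_max_def rx_power_def)

lemma secrecy_rate_pos_iff:
  assumes "0 < P" "0 < n" "0 < g (dist x y) (z x y)" "0 < g (dist x e) (z x e)"
  shows "0 < secrecy_rate P n n g z x y e \<longleftrightarrow> g (dist x e) (z x e) < g (dist x y) (z x y)"
proof -
  have "0 < 1 + P * g (dist x y) (z x y) / n" "0 < 1 + P * g (dist x e) (z x e) / n"
    using assms by (auto intro!: add_pos_pos)
  then show ?thesis
    using assms by (simp add: secrecy_rate_def rx_power_def less_max_iff_disj divide_less_cancel)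
qed

end

theory Submission
  imports Defs
begin

text \<open>
  Conditionally on the positions, the gains seen from the origin are independent, so by the
  marking argument the gains of the legitimate nodes and of the eavesdroppers are two
  independent Poisson processes on the half line whose mean measures are proportional, with
  ratio \<open>lam_l / lam_e\<close>.  If \<open>G t\<close> is the mean number of gains above \<open>t\<close> per unit density, the
  largest eavesdropper gain \<open>T\<close> has distribution function \<open>exp (- lam_e * G t)\<close>, and the
  number of legitimate gains above \<open>t\<close> has generating function \<open>exp (- (1 - s) * lam_l * G t)\<close>,
  which is the power \<open>(1 - s) * lam_l / lam_e\<close> of that distribution function.  The law of \<open>T\<close>
  has no atoms, so averaging over \<open>T\<close> gives the integral of this power over the unit interval,
  the generating function of a geometric law.  The marks enter only through \<open>G\<close>, which has
  cancelled.
\<close>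

section \<open>The exponential of an extended nonnegative exponent\<close>

text \<open>Only the random sets \<open>\<Phi>l\<close> and \<open>\<Phi>e\<close> have prescribed
  laws; the enumerations \<open>L\<close> and \<open>E\<close> are arbitrary, so a single point
  \<open>L j\<close> has no usable law, and even the index of the typical node is random. Hence the
  marks are averaged out in finite products along the enumeration, with all positions frozen. Only
  the limit of these products is symmetric in the points: it is the exponential of a sum over the
  set, whose mean is the Laplace functional, and this follows from the counts in bounded sets.
  Weights may be 0 (void probabilities) and mean numbers of points infinite, so exponents live in
  \<open>ennreal\<close>. Marking yields identities for fixed thresholds, whereas the threshold that
  decides the edges is the random \<open>T\<close>. Squeezing between the quantiles of
  \<open>T\<close> bridges this gap without conditional distributions. Finally, the out-degree event
  itself need not be measurable; it is only shown to agree almost surely with an event about the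
  gains.\<close>

definition exp_neg :: "ennreal \<Rightarrow> real" where
  "exp_neg x = (if x = \<top> then 0 else exp (- enn2real x))"

text \<open>The inverse of \<open>exp_neg\<close> on the unit interval. The value \<top> at 0 allows
  a product with a vanishing factor to be written as \<open>exp_neg\<close> of a sum.\<close>

definition neg_ln :: "real \<Rightarrow> ennreal" where
  "neg_ln p = (if p \<le> 0 then \<top> else ennreal (- ln p))"

lemma exp_neg_0 [simp]: "exp_neg 0 = 1"
  by (simp add: exp_neg_def)

lemma exp_neg_ennreal [simp]: "0 \<le> r \<Longrightarrow> exp_neg (ennreal r) = exp (- r)"
  by (simp add: exp_neg_def)

lemma exp_neg_top [simp]: "exp_neg \<top> = 0"
  by (simp add: exp_neg_def)

lemma exp_neg_nonneg [simp]: "0 \<le> exp_neg x"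
  by (simp add: exp_neg_def)

lemma exp_neg_le_1 [simp]: "exp_neg x \<le> 1"
  by (simp add: exp_neg_def)

lemma exp_neg_antimono: "x \<le> y \<Longrightarrow> exp_neg y \<le> exp_neg x"
  by (auto simp: exp_neg_def top_unique enn2real_mono less_top)

lemma exp_neg_add: "exp_neg (x + y) = exp_neg x * exp_neg y"
  by (auto simp: exp_neg_def enn2real_plus less_top exp_add[symmetric] ennreal_add_eq_top)

lemma exp_neg_sum: "exp_neg (\<Sum>i\<in>I. x i) = (\<Prod>i\<in>I. exp_neg (x i))"
  by (induction I rule: infinite_finite_induct) (simp_all add: exp_neg_add)

lemma exp_neg_neg_ln [simp]: "0 \<le> p \<Longrightarrow> p \<le> 1 \<Longrightarrow> exp_neg (neg_ln p) = p"
  by (auto simp: neg_ln_def)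

lemma measurable_exp_neg [measurable]: "exp_neg \<in> borel_measurable borel"
  unfolding exp_neg_def by measurable

lemma measurable_neg_ln [measurable]: "neg_ln \<in> borel_measurable borel"
  unfolding neg_ln_def by measurable

text \<open>Continuity at \<top> is the point: partial sums of exponents may diverge, and the
  products then have to tend to 0.\<close>

lemma tendsto_exp_neg:
  assumes "(X \<longlongrightarrow> x) F"
  shows "((\<lambda>i. exp_neg (X i)) \<longlongrightarrow> exp_neg x) F"
proof (cases "x = \<top>")
  case False
  then have "eventually (\<lambda>i. X i < \<top>) F"
    using assms order_tendstoD(2) by (auto simp: less_top)
  moreover have "((\<lambda>i. exp (- enn2real (X i))) \<longlongrightarrow> exp (- enn2real x)) F"
    using False assms by (intro tendsto_intros) (auto simp: ennreal_enn2real less_top)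
  ultimately show ?thesis
    using False by (auto simp: exp_neg_def elim!: Lim_transform_eventually eventually_mono)
next
  case True
  show ?thesis
  proof (rule order_tendstoI)
    fix a assume "a < exp_neg x"
    then have "a < 0" using True by simp
    then show "eventually (\<lambda>i. a < exp_neg (X i)) F"
      by (auto intro!: always_eventually less_le_trans[of a 0])
  next
    fix a assume "exp_neg x < a"
    then have a: "0 < a" using True by simp
    \<comment> \<open>Chosen so that \<open>exp (- r)\<close> is at most \<open>a / exp 1\<close>;
      the maximum with 1 keeps \<open>r\<close> nonnegative, so that \<open>ennreal r\<close> loses
      nothing.\<close>
    define r where "r = max 1 (1 - ln a)"
    have r: "0 \<le> r" "exp (- r) < a"
    proof -
      have "exp (- r) \<le> exp (ln a - 1)" by (auto simp: r_def)
      also have "\<dots> < exp (ln a)" by (subst exp_less_cancel_iff) simp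
      finally show "exp (- r) < a" using a by simp
    qed (simp add: r_def)
    have "eventually (\<lambda>i. ennreal r < X i) F"
      using assms True by (intro order_tendstoD(1)) (auto simp: ennreal_less_top)
    then show "eventually (\<lambda>i. exp_neg (X i) < a) F"
    proof eventually_elim
      case (elim i)
      have "exp_neg (X i) \<le> exp (- r)"
        using exp_neg_antimono[of "ennreal r" "X i"] elim r by simp
      then show ?case using r by simp
    qed
  qed
qed

section \<open>The Laplace functional of a Poisson process\<close>

lemma space_config_space [simp]: "space config_space = configs"
  unfolding config_space_def by (rule space_measure_of) auto

lemma measurable_config_card [measurable]:
  assumes "B \<in> sets borel" "bounded B"
  shows "(\<lambda>\<phi>. card (\<phi> \<inter> B)) \<in> measurable config_space (count_space UNIV)"
proof -
  have "{\<phi> \<in> configs. card (\<phi> \<inter> B) = k} \<in> sets config_space" for k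
    unfolding config_space_def using assms
    by (subst sets_measure_of) (auto intro!: sigma_sets.Basic)
  moreover have "(\<lambda>\<phi>. card (\<phi> \<inter> B)) -` {k} \<inter> space config_space
      = {\<phi> \<in> configs. card (\<phi> \<inter> B) = k}" for k
    by auto
  ultimately show ?thesis
    by (intro measurable_count_space_eq_countable[THEN iffD2]) auto
qed

text \<open>Written as an integral over a counting measure, so that monotone convergence applies and
  no enumeration of the configuration is involved.\<close>

definition config_sum :: "(plane \<Rightarrow> ennreal) \<Rightarrow> plane set \<Rightarrow> ennreal" where
  "config_sum u \<phi> = (\<integral>\<^sup>+x. u x \<partial>count_space \<phi>)"

text \<open>Boundedness of the nonzero level sets makes the counts finite, so that
  \<open>card\<close> is a true count and not its default 0 on infinite sets.\<close>

lemma config_sum_simple: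
  assumes u: "simple_function borel u" and b: "\<And>a. a \<noteq> 0 \<Longrightarrow> bounded (u -` {a})"
    and \<phi>: "\<phi> \<in> configs"
  shows "config_sum u \<phi> = (\<Sum>a\<in>range u - {0}. a * of_nat (card (\<phi> \<inter> u -` {a})))"
proof -
  have fin: "finite (range u)"
    using u by (auto dest: simple_functionD)
  have "config_sum u \<phi> = (\<integral>\<^sup>+x. (\<Sum>a\<in>range u - {0}. a * indicator (u -` {a}) x) \<partial>count_space \<phi>)"
    unfolding config_sum_def
  proof (rule nn_integral_cong)
    fix x
    have "(\<Sum>a\<in>range u - {0}. a * indicator (u -` {a}) x)
        = (\<Sum>a\<in>range u - {0}. if u x = a then u x else 0)"
      by (intro sum.cong) (auto simp: indicator_def)
    also have "\<dots> = u x" using fin by (simp add: sum.delta)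
    finally show "u x = (\<Sum>a\<in>range u - {0}. a * indicator (u -` {a}) x)" by simp
  qed
  also have "\<dots> = (\<Sum>a\<in>range u - {0}. a * emeasure (count_space \<phi>) (\<phi> \<inter> u -` {a}))"
  proof (subst nn_integral_sum)
    fix a
    show "(\<lambda>x. a * indicator (u -` {a}) x) \<in> borel_measurable (count_space \<phi>)" by simp
  next
    show "(\<Sum>a\<in>range u - {0}. \<integral>\<^sup>+x. a * indicator (u -` {a}) x \<partial>count_space \<phi>)
      = (\<Sum>a\<in>range u - {0}. a * emeasure (count_space \<phi>) (\<phi> \<inter> u -` {a}))"
      by (intro sum.cong refl)
         (subst nn_integral_cmult_indicator[symmetric], auto intro!: nn_integral_cong simp: indicator_def)
  qed
  also have "\<dots> = (\<Sum>a\<in>range u - {0}. a * of_nat (card (\<phi> \<inter> u -` {a})))"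
  proof (intro sum.cong refl)
    fix a assume "a \<in> range u - {0}"
    then have "finite (\<phi> \<inter> u -` {a})"
      using b \<phi> by (auto simp: configs_def)
    then show "a * emeasure (count_space \<phi>) (\<phi> \<inter> u -` {a}) = a * of_nat (card (\<phi> \<inter> u -` {a}))"
      by (simp add: emeasure_count_space)
  qed
  finally show ?thesis .
qed

lemma config_sum_SUP:
  assumes "incseq v"
  shows "config_sum (\<lambda>x. SUP i. v i x) \<phi> = (SUP i. config_sum (v i) \<phi>)"
  unfolding config_sum_def by (rule nn_integral_monotone_convergence_SUP[OF assms]) simp

text \<open>The usual simple approximations are cut off by growing balls, because a point process is
  described only by its counts in bounded sets.\<close>

lemma simple_bounded_support_approx:
  fixes u :: "plane \<Rightarrow> ennreal"
  assumes "u \<in> borel_measurable borel"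
  obtains v :: "nat \<Rightarrow> plane \<Rightarrow> ennreal" where
    "\<And>i. simple_function borel (v i)" "incseq v" "\<And>i x. v i x < \<top>"
    "\<And>i a. a \<noteq> 0 \<Longrightarrow> bounded (v i -` {a})" "u = (\<lambda>x. SUP i. v i x)"
proof -
  obtain f :: "nat \<Rightarrow> plane \<Rightarrow> ennreal" where f: "\<And>i. simple_function borel (f i)" "incseq f" "\<And>i x. f i x < \<top>"
      "\<And>x. (SUP i. f i x) = u x"
    by (rule borel_measurable_implies_simple_function_sequence'[OF assms]) (rule that; assumption)
  define v :: "nat \<Rightarrow> plane \<Rightarrow> ennreal"
    where "v i x = f i x * indicator (ball 0 (real i)) x" for i x
  have mono: "f i x \<le> f j x" if "i \<le> j" for i j x
    using f(2) that by (auto simp: incseq_def le_fun_def)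
  have "incseq v"
    by (auto simp: incseq_def le_fun_def v_def indicator_def mono)
  moreover have "simple_function borel (v i)" for i
    unfolding v_def using f(1) by (intro simple_function_mult simple_function_indicator) auto
  moreover have "v i x < \<top>" for i x
    using f(3) by (auto simp: v_def indicator_def)
  moreover have "bounded (v i -` {a})" if "a \<noteq> 0" for i a
  proof (rule bounded_subset)
    show "v i -` {a} \<subseteq> ball 0 (real i)" using that by (auto simp: v_def indicator_def split: if_splits)
  qed simp
  moreover have "u x = (SUP i. v i x)" for x
  proof (rule antisym)
    show "u x \<le> (SUP i. v i x)"
      unfolding f(4)[symmetric]
    proof (rule SUP_least)
      fix i
      obtain j where j: "norm x < real j" using reals_Archimedean2 by blast
      have "f i x \<le> f (max i j) x" by (rule mono) simp
      also have "\<dots> = v (max i j) x" using j by (auto simp: v_def indicator_def)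
      finally show "f i x \<le> (SUP i. v i x)" by (auto intro: SUP_upper2)
    qed
    show "(SUP i. v i x) \<le> u x"
      unfolding f(4)[symmetric] by (rule SUP_mono) (auto simp: v_def indicator_def)
  qed
  ultimately show thesis
    by (intro that[of v]) (assumption | rule ext)+
qed

lemma measurable_config_sum [measurable]:
  assumes "u \<in> borel_measurable borel"
  shows "config_sum u \<in> borel_measurable config_space"
proof -
  obtain v :: "nat \<Rightarrow> plane \<Rightarrow> ennreal" where
    v: "\<And>i. simple_function borel (v i)" "incseq v"
      "\<And>i a. a \<noteq> 0 \<Longrightarrow> bounded (v i -` {a})" "u = (\<lambda>x. SUP i. v i x)"
    using simple_bounded_support_approx[OF assms] by metis
  have "(\<lambda>\<phi>. \<Sum>a\<in>range (v i) - {0}. a * of_nat (card (\<phi> \<inter> v i -` {a})))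
      \<in> borel_measurable config_space" for i
  proof (intro borel_measurable_sum borel_measurable_times_ennreal borel_measurable_const)
    fix a assume "a \<in> range (v i) - {0}"
    then have "(\<lambda>\<phi>. card (\<phi> \<inter> v i -` {a})) \<in> measurable config_space (count_space UNIV)"
      using v simple_functionD(2)[OF v(1), of i "{a}"] by (intro measurable_config_card) auto
    then show "(\<lambda>\<phi>. of_nat (card (\<phi> \<inter> v i -` {a})) :: ennreal) \<in> borel_measurable config_space"
      by (rule measurable_compose) simp
  qed
  then have "config_sum (v i) \<in> borel_measurable config_space" for i
    by (rule measurable_cong[THEN iffD1, rotated]) (auto simp: config_sum_simple v)
  moreover have "config_sum u = (\<lambda>\<phi>. SUP i. config_sum (v i) \<phi>)"
    unfolding v(4) config_sum_SUP[OF v(2)] ..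
  ultimately show ?thesis by simp
qed

text \<open>This is where the order of an enumeration disappears: a series of nonnegative terms
  along any enumeration has the same sum.\<close>

lemma config_sum_bij_betw:
  assumes "bij_betw X (UNIV :: nat set) \<phi>"
  shows "(\<lambda>n. \<Sum>j<n. u (X j)) \<longlonglongrightarrow> config_sum u \<phi>"
proof -
  have "config_sum u \<phi> = (\<Sum>j. u (X j))"
    unfolding config_sum_def using assms
    by (subst nn_integral_bij_count_space[symmetric, of X UNIV]) (auto simp: nn_integral_count_space_nat)
  then show ?thesis by (simp add: summable_LIMSEQ)
qed

lemma config_sum_insert_0: "u 0 = 0 \<Longrightarrow> config_sum u (insert 0 \<phi>) = config_sum u \<phi>"
  unfolding config_sum_def by (rule nn_integral_count_space_eq) auto

text \<open>The exponential series. The case \<open>c = 0\<close> is included, with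
  \<open>0 ^ 0 = 1\<close>, and gives the void probability.\<close>

lemma (in prob_space) poisson_pgf:
  fixes N :: "'a \<Rightarrow> nat"
  assumes [measurable]: "N \<in> measurable M (count_space UNIV)"
    and P: "\<And>k. measure M {\<omega> \<in> space M. N \<omega> = k} = m ^ k / fact k * exp (- m)"
    and m: "0 \<le> m" and c: "0 \<le> c" "c \<le> 1"
  shows "(\<integral>\<^sup>+\<omega>. ennreal (c ^ N \<omega>) \<partial>M) = ennreal (exp (- (m * (1 - c))))"
proof -
  have "(\<integral>\<^sup>+\<omega>. ennreal (c ^ N \<omega>) \<partial>M)
      = (\<integral>\<^sup>+\<omega>. (\<Sum>k. ennreal (c ^ k) * indicator {\<omega> \<in> space M. N \<omega> = k} \<omega>) \<partial>M)"
  proof (rule nn_integral_cong)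
    fix \<omega> assume "\<omega> \<in> space M"
    then have "(\<lambda>k. ennreal (c ^ k) * indicator {\<omega> \<in> space M. N \<omega> = k} \<omega>)
        = (\<lambda>k. if k = N \<omega> then ennreal (c ^ k) else 0)"
      by (auto simp: indicator_def)
    then show "ennreal (c ^ N \<omega>) = (\<Sum>k. ennreal (c ^ k) * indicator {\<omega> \<in> space M. N \<omega> = k} \<omega>)"
      using sums_single[of "N \<omega>" "\<lambda>k. ennreal (c ^ k)"] by (simp add: sums_iff)
  qed
  also have "\<dots> = (\<Sum>k. ennreal (c ^ k) * emeasure M {\<omega> \<in> space M. N \<omega> = k})"
    by (subst nn_integral_suminf) (auto simp: nn_integral_cmult_indicator)
  also have "\<dots> = (\<Sum>k. ennreal (exp (- m) * ((m * c) ^ k / fact k)))"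
    using c m by (intro suminf_cong)
      (simp add: emeasure_eq_measure P ennreal_mult'[symmetric] power_mult_distrib field_simps)
  also have "\<dots> = ennreal (exp (- m) * exp (m * c))"
  proof (rule suminf_ennreal_eq)
    show "(\<lambda>k. exp (- m) * ((m * c) ^ k / fact k)) sums (exp (- m) * exp (m * c))"
      using exp_converges[of "m * c"] by (intro sums_mult) (simp add: field_simps scaleR_conv_of_real)
  qed (use c m in auto)
  finally show ?thesis by (simp add: exp_add[symmetric] algebra_simps)
qed

lemma emeasure_lborel_bounded:
  "bounded B \<Longrightarrow> emeasure lborel (B :: plane set) = ennreal (measure lborel B)"
  by (rule emeasure_eq_ennreal_measure) (use emeasure_bounded_finite[of B] in auto)

text \<open>The level sets of the nonzero values are disjoint, bounded and Borel, so their counts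
  are independent Poisson variables and the mean factors into generating functions. The zero level
  set may be unbounded but contributes exponent 0.\<close>

lemma (in prob_space) laplace_functional_simple:
  assumes pp: "poisson_process M lam \<Phi>" and lam: "0 \<le> lam"
    and u: "simple_function borel u" and b: "\<And>a. a \<noteq> 0 \<Longrightarrow> bounded (u -` {a})"
    and fin: "\<And>x. u x < \<top>"
  shows "(\<integral>\<^sup>+\<omega>. ennreal (exp_neg (config_sum u (\<Phi> \<omega>))) \<partial>M) =
         ennreal (exp_neg (ennreal lam * (\<integral>\<^sup>+x. ennreal (1 - exp_neg (u x)) \<partial>lborel)))"
proof -
  have \<Phi>[measurable]: "\<Phi> \<in> measurable M config_space"
    and cnt: "\<And>B k. B \<in> sets borel \<Longrightarrow> bounded B \<Longrightarrow> measure M {\<omega> \<in> space M. card (\<Phi> \<omega> \<inter> B) = k} =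
          (lam * measure lborel B) ^ k / fact k * exp (- (lam * measure lborel B))"
    and ind: "\<And>B n. (\<And>i. i < n \<Longrightarrow> B i \<in> sets borel \<and> bounded (B i)) \<Longrightarrow> disjoint_family_on B {..<n}
       \<Longrightarrow> indep_vars (\<lambda>_. count_space UNIV) (\<lambda>i \<omega>. card (\<Phi> \<omega> \<inter> B i)) {..<n::nat}"
    using pp unfolding poisson_process_def by auto
  have conf: "\<omega> \<in> space M \<Longrightarrow> \<Phi> \<omega> \<in> configs" for \<omega>
    using measurable_space[OF \<Phi>] by simp
  have "finite (range u - {0})"
    using u by (auto dest: simple_functionD)
  \<comment> \<open>The values are numbered by an initial segment because independence of the counts
    is postulated for families indexed by \<open>{..<n}\<close>.\<close>
  then obtain a :: "nat \<Rightarrow> ennreal" and m where "bij_betw a {..<m} (range u - {0})"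
    using ex_bij_betw_nat_finite by (metis lessThan_atLeast0)
  note bij = this
  define B where "B i = u -` {a i}" for i
  have a: "a i \<noteq> 0" "a i < \<top>" if "i < m" for i
  proof -
    have "a i \<in> range u - {0}" using bij_betwE[OF bij] that by blast
    then show "a i \<noteq> 0" "a i < \<top>" using fin by auto
  qed
  have B: "B i \<in> sets borel" "bounded (B i)" if "i < m" for i
    using simple_functionD(2)[OF u, of "{a i}"] b a that by (auto simp: B_def)
  have disj: "disjoint_family_on B {..<m}"
    using bij by (auto simp: disjoint_family_on_def B_def bij_betw_def inj_on_def)
  have sum_reindex: "(\<Sum>x\<in>range u - {0}. F x) = (\<Sum>i<m. F (a i))" for F :: "ennreal \<Rightarrow> ennreal"
    using sum.reindex_bij_betw[OF bij, of F] by simp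
  have c: "0 \<le> exp_neg (a i)" "exp_neg (a i) \<le> 1" for i by auto
  have en_mult: "exp_neg (a i * of_nat k) = exp_neg (a i) ^ k" for i k
    by (induction k) (simp_all add: distrib_left exp_neg_add)
  have "(\<integral>\<^sup>+\<omega>. ennreal (exp_neg (config_sum u (\<Phi> \<omega>))) \<partial>M)
      = (\<integral>\<^sup>+\<omega>. (\<Prod>i<m. ennreal (exp_neg (a i) ^ card (\<Phi> \<omega> \<inter> B i))) \<partial>M)"
    by (intro nn_integral_cong)
       (simp add: config_sum_simple[OF u b conf] sum_reindex exp_neg_sum en_mult B_def prod_ennreal)
  also have "\<dots> = (\<Prod>i<m. \<integral>\<^sup>+\<omega>. ennreal (exp_neg (a i) ^ card (\<Phi> \<omega> \<inter> B i)) \<partial>M)"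
    by (intro indep_vars_nn_integral indep_vars_compose2[OF ind[OF _ disj]]) (auto simp: B)
  also have "\<dots> = (\<Prod>i<m. ennreal (exp (- (lam * measure lborel (B i) * (1 - exp_neg (a i))))))"
    using lam B c
    by (intro prod.cong refl poisson_pgf) (auto simp: cnt intro: measurable_compose[OF \<Phi>])
  also have "\<dots> = ennreal (exp (- (\<Sum>i<m. lam * measure lborel (B i) * (1 - exp_neg (a i)))))"
    by (simp add: prod_ennreal exp_sum sum_negf[symmetric])
  also have "\<dots> = ennreal (exp_neg (ennreal lam * (\<Sum>i<m. ennreal (1 - exp_neg (a i)) * emeasure lborel (B i))))"
  proof -
    have "ennreal lam * (\<Sum>i<m. ennreal (1 - exp_neg (a i)) * emeasure lborel (B i))
       = (\<Sum>i<m. ennreal (lam * measure lborel (B i) * (1 - exp_neg (a i))))"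
      using lam by (auto simp: sum_distrib_left emeasure_lborel_bounded B ennreal_mult' mult_ac intro!: sum.cong)
    also have "\<dots> = ennreal (\<Sum>i<m. lam * measure lborel (B i) * (1 - exp_neg (a i)))"
      using lam by (intro sum_ennreal) auto
    finally show ?thesis using lam by (simp add: sum_nonneg)
  qed
  also have "(\<Sum>i<m. ennreal (1 - exp_neg (a i)) * emeasure lborel (B i))
      = (\<integral>\<^sup>+x. ennreal (1 - exp_neg (u x)) \<partial>lborel)"
  proof -
    have "(\<integral>\<^sup>+x. ennreal (1 - exp_neg (u x)) \<partial>lborel)
        = (\<integral>\<^sup>+x. (\<Sum>i<m. ennreal (1 - exp_neg (a i)) * indicator (B i) x) \<partial>lborel)"
    proof (rule nn_integral_cong)
      fix x
      have "(\<Sum>i<m. ennreal (1 - exp_neg (a i)) * indicator (B i) x)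
          = (\<Sum>y\<in>range u - {0}. ennreal (1 - exp_neg y) * indicator (u -` {y}) x)"
        by (simp add: sum_reindex B_def)
      also have "\<dots> = (\<Sum>y\<in>range u - {0}. if u x = y then ennreal (1 - exp_neg (u x)) else 0)"
        by (intro sum.cong) (auto simp: indicator_def)
      also have "\<dots> = ennreal (1 - exp_neg (u x))"
        using \<open>finite (range u - {0})\<close> by (simp add: sum.delta)
      finally show "ennreal (1 - exp_neg (u x)) = (\<Sum>i<m. ennreal (1 - exp_neg (a i)) * indicator (B i) x)"
        by simp
    qed
    also have "\<dots> = (\<Sum>i<m. ennreal (1 - exp_neg (a i)) * emeasure lborel (B i))"
      using B by (subst nn_integral_sum) (auto intro!: sum.cong nn_integral_cmult_indicator)
    finally show ?thesis by simp
  qed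
  finally show ?thesis .
qed

text \<open>Both sides pass to the limit along the simple approximations: the left by dominated
  convergence, the inner integral on the right by monotone convergence, since
  \<open>1 - exp_neg\<close> increases.\<close>

lemma (in prob_space) laplace_functional:
  assumes pp: "poisson_process M lam \<Phi>" and lam: "0 \<le> lam"
    and u[measurable]: "u \<in> borel_measurable borel"
  shows "(\<integral>\<^sup>+\<omega>. ennreal (exp_neg (config_sum u (\<Phi> \<omega>))) \<partial>M) =
         ennreal (exp_neg (ennreal lam * (\<integral>\<^sup>+x. ennreal (1 - exp_neg (u x)) \<partial>lborel)))"
proof -
  have \<Phi>[measurable]: "\<Phi> \<in> measurable M config_space"
    using pp unfolding poisson_process_def by auto
  obtain v :: "nat \<Rightarrow> plane \<Rightarrow> ennreal" where
    v: "\<And>i. simple_function borel (v i)" "incseq v" "\<And>i x. v i x < \<top>"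
      "\<And>i a. a \<noteq> 0 \<Longrightarrow> bounded (v i -` {a})" "u = (\<lambda>x. SUP i. v i x)"
    using simple_bounded_support_approx[OF u] by metis
  have v_meas[measurable]: "v i \<in> borel_measurable borel" for i
    using v(1) by (rule borel_measurable_simple_function)
  have mono: "v i x \<le> v j x" if "i \<le> j" for i j x
    using v(2) that by (auto simp: incseq_def le_fun_def)
  have lim: "(\<lambda>i. v i x) \<longlonglongrightarrow> u x" for x
    unfolding v(5) using mono by (intro LIMSEQ_SUP) (auto simp: incseq_def)
  have "(\<lambda>i. config_sum (v i) \<phi>) \<longlonglongrightarrow> config_sum u \<phi>" for \<phi>
    unfolding v(5) config_sum_SUP[OF v(2)]
    by (intro LIMSEQ_SUP) (auto simp: incseq_def config_sum_def intro!: nn_integral_mono mono)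
  then have lhs: "(\<lambda>i. \<integral>\<^sup>+\<omega>. ennreal (exp_neg (config_sum (v i) (\<Phi> \<omega>))) \<partial>M)
      \<longlonglongrightarrow> (\<integral>\<^sup>+\<omega>. ennreal (exp_neg (config_sum u (\<Phi> \<omega>))) \<partial>M)"
    by (intro nn_integral_dominated_convergence[where w="\<lambda>_. 1"])
       (auto intro!: AE_I2 tendsto_ennrealI tendsto_exp_neg simp: emeasure_space_1)
  have "(\<lambda>i. \<integral>\<^sup>+x. ennreal (1 - exp_neg (v i x)) \<partial>lborel)
      \<longlonglongrightarrow> (\<integral>\<^sup>+x. ennreal (1 - exp_neg (u x)) \<partial>lborel)"
  proof (rule nn_integral_LIMSEQ)
    show "incseq (\<lambda>i x. ennreal (1 - exp_neg (v i x)))"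
      by (auto simp: incseq_def le_fun_def intro!: ennreal_leI exp_neg_antimono mono)
    show "(\<lambda>i. ennreal (1 - exp_neg (v i x))) \<longlonglongrightarrow> ennreal (1 - exp_neg (u x))" for x
      by (intro tendsto_ennrealI tendsto_diff tendsto_const tendsto_exp_neg lim)
  qed simp
  then have rhs: "(\<lambda>i. ennreal (exp_neg (ennreal lam * (\<integral>\<^sup>+x. ennreal (1 - exp_neg (v i x)) \<partial>lborel))))
      \<longlonglongrightarrow> ennreal (exp_neg (ennreal lam * (\<integral>\<^sup>+x. ennreal (1 - exp_neg (u x)) \<partial>lborel)))"
    by (intro tendsto_ennrealI tendsto_exp_neg ennreal_tendsto_cmult) auto
  have eq: "(\<lambda>i. \<integral>\<^sup>+\<omega>. ennreal (exp_neg (config_sum (v i) (\<Phi> \<omega>))) \<partial>M) =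
      (\<lambda>i. ennreal (exp_neg (ennreal lam * (\<integral>\<^sup>+x. ennreal (1 - exp_neg (v i x)) \<partial>lborel))))"
    by (intro ext laplace_functional_simple[OF pp lam v(1) v(4) v(3)])
  show ?thesis
    by (rule LIMSEQ_unique[OF lhs rhs[folded eq]])
qed

lemma (in prob_space) poisson_process_null_set:
  assumes pp: "poisson_process M lam \<Phi>"
    and B: "B \<in> sets borel" "bounded B" "measure lborel B = 0"
  shows "AE \<omega> in M. \<Phi> \<omega> \<inter> B = {}"
proof -
  have \<Phi>[measurable]: "\<Phi> \<in> measurable M config_space"
    using pp unfolding poisson_process_def by auto
  have [measurable]: "(\<lambda>\<omega>. card (\<Phi> \<omega> \<inter> B)) \<in> measurable M (count_space UNIV)"
    using B by (intro measurable_compose[OF \<Phi>] measurable_config_card)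
  \<comment> \<open>With mean 0 the Poisson weight at 0 is
    \<open>0 ^ 0 / fact 0 * exp 0 = 1\<close>.\<close>
  have "prob {\<omega> \<in> space M. card (\<Phi> \<omega> \<inter> B) = 0} = 1"
    using pp B unfolding poisson_process_def by auto
  then have "AE \<omega> in M. card (\<Phi> \<omega> \<inter> B) = 0"
    by (subst (asm) prob_Collect_eq_1) auto
  then show ?thesis
    using AE_space
  proof eventually_elim
    case (elim \<omega>)
    \<comment> \<open>A \<open>card\<close> of 0 could also come from an infinite set; local
      finiteness excludes that.\<close>
    have "finite (\<Phi> \<omega> \<inter> B)"
      using measurable_space[OF \<Phi>, of \<omega>] elim B by (auto simp: configs_def)
    then show ?case using elim by simp
  qed
qed

section \<open>Geometric laws from races\<close>

text \<open>For \<open>0 \<le> s < 1\<close> the value 0 on infinite sets is the limit of the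
  powers. For \<open>s = 0\<close> this is the indicator of \<open>J = {}\<close>, so void events
  and generating functions share one formula.\<close>

definition card_power :: "real \<Rightarrow> nat set \<Rightarrow> real" where
  "card_power s J = (if finite J then s ^ card J else 0)"

lemma card_power_bounds:
  assumes "0 \<le> s" "s \<le> 1"
  shows "0 \<le> card_power s J" "card_power s J \<le> 1"
  using assms by (auto simp: card_power_def power_le_one)

lemma card_power_antimono:
  assumes "0 \<le> s" "s \<le> 1" "I \<subseteq> J"
  shows "card_power s J \<le> card_power s I"
  using assms
  by (auto simp: card_power_def card_mono power_decreasing dest: finite_subset)

text \<open>If \<open>J\<close> is infinite, the counts in initial segments diverge and
  \<open>s < 1\<close> sends the powers to 0. These finite products give both measurability and
  access to the marks.\<close>

lemma tendsto_card_power: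
  assumes s: "0 \<le> s" "s < 1"
  shows "(\<lambda>n. \<Prod>j<n. if j \<in> J then s else 1) \<longlonglongrightarrow> card_power s J"
proof -
  have eq: "(\<Prod>j<n. if j \<in> J then s else 1) = s ^ card ({..<n} \<inter> J)" for n :: nat
    by (simp add: prod.If_cases)
  show ?thesis
  proof (cases "finite J")
    case True
    then obtain k where k: "J \<subseteq> {..<k}"
      using finite_nat_iff_bounded by blast
    have "eventually (\<lambda>n. s ^ card ({..<n} \<inter> J) = s ^ card J) sequentially"
      using eventually_ge_at_top[of k]
    proof eventually_elim
      case (elim n)
      then have "{..<n} \<inter> J = J" using k by auto
      then show ?case by simp
    qed
    then show ?thesis
      unfolding eq card_power_def using True by (simp add: tendsto_eventually)
  next
    case False
    have "filterlim (\<lambda>n. card ({..<n} \<inter> J)) at_top sequentially"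
      unfolding filterlim_at_top
    proof
      fix k
      obtain F where F: "finite F" "card F = k" "F \<subseteq> J"
        using infinite_arbitrarily_large[OF False] by blast
      then obtain m where m: "F \<subseteq> {..<m}"
        using finite_nat_iff_bounded by blast
      show "eventually (\<lambda>n. k \<le> card ({..<n} \<inter> J)) sequentially"
        using eventually_ge_at_top[of m]
      proof eventually_elim
        case (elim n)
        then show ?case using F m by (auto intro!: card_mono simp flip: F(2))
      qed
    qed
    then have "(\<lambda>n. s ^ card ({..<n} \<inter> J)) \<longlonglongrightarrow> 0"
      using s by (intro filterlim_compose[OF LIMSEQ_power_zero]) auto
    then show ?thesis
      unfolding eq card_power_def using False by simp
  qed
qed

text \<open>Once the lower coefficients vanish, dividing by \<open>s ^ n\<close> bounds
  \<open>\<bar>c n\<bar>\<close> by the geometric tail \<open>s / (1 - s)\<close>, which tends to 0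
  as \<open>s\<close> decreases to 0.\<close>

lemma power_series_zero_imp_coeff_zero:
  fixes c :: "nat \<Rightarrow> real"
  assumes b: "\<And>n. \<bar>c n\<bar> \<le> 1" and z: "\<And>s. 0 < s \<Longrightarrow> s < 1 \<Longrightarrow> (\<lambda>n. c n * s ^ n) sums 0"
  shows "c n = 0"
proof (induction n rule: less_induct)
  case (less n)
  have bound: "\<bar>c n\<bar> \<le> s / (1 - s)" if s: "0 < s" "s < 1" for s
  proof -
    have "(\<lambda>k. c (k + Suc n) * s ^ (k + Suc n)) sums (0 - (\<Sum>k<Suc n. c k * s ^ k))"
      by (rule sums_split_initial_segment[OF z[OF s]])
    then have 1: "(\<lambda>k. c (k + Suc n) * s ^ (k + Suc n)) sums (- (c n * s ^ n))"
      using less by simp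
    have 2: "(\<lambda>k. s ^ Suc n * s ^ k) sums (s ^ Suc n * (1 / (1 - s)))"
      using s by (intro sums_mult geometric_sums) auto
    have le: "norm (c (k + Suc n) * s ^ (k + Suc n)) \<le> s ^ Suc n * s ^ k" for k
    proof -
      have "norm (c (k + Suc n) * s ^ (k + Suc n)) \<le> 1 * s ^ (k + Suc n)"
        using b[of "k + Suc n"] s by (simp only: norm_mult) (intro mult_mono, auto simp: power_abs)
      then show ?thesis by (simp add: power_add mult_ac)
    qed
    have "norm (\<Sum>k. c (k + Suc n) * s ^ (k + Suc n)) \<le> (\<Sum>k. s ^ Suc n * s ^ k)"
      by (intro norm_suminf_le le sums_summable[OF 2])
    then have "s ^ n * \<bar>c n\<bar> \<le> s ^ n * (s / (1 - s))"
      using 1 2 s by (simp add: sums_iff abs_mult mult.commute)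
    then show ?thesis
      using s by (subst (asm) mult_le_cancel_left_pos) auto
  qed
  have "((\<lambda>s. s / (1 - s)) \<longlongrightarrow> 0 / (1 - 0)) (at_right (0::real))"
    by (intro tendsto_intros) auto
  moreover have "eventually (\<lambda>s. \<bar>c n\<bar> \<le> s / (1 - s)) (at_right 0)"
    using eventually_at_right_less[of "0::real"] eventually_at_right[of 0 "1::real"]
    by (auto simp: eventually_at_right intro!: bound exI[of _ 1])
  ultimately have "\<bar>c n\<bar> \<le> 0"
    by (intro tendsto_lowerbound) auto
  then show ?case by simp
qed

section \<open>Riemann sums of a power function on the unit interval\<close>

lemma powr_increment_bounds:
  fixes a x y :: real
  assumes a: "0 \<le> a" and xy: "0 \<le> x" "x < y"
  shows "(y - x) * x powr a \<le> (y powr (a + 1) - x powr (a + 1)) / (a + 1)"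
    and "(y powr (a + 1) - x powr (a + 1)) / (a + 1) \<le> (y - x) * y powr a"
proof -
  have "(y - x) * x powr a \<le> (y powr (a + 1) - x powr (a + 1)) / (a + 1) \<and>
    (y powr (a + 1) - x powr (a + 1)) / (a + 1) \<le> (y - x) * y powr a"
  \<comment> \<open>The derivative of \<open>powr\<close> is taken only at positive points, so an
    interval starting at 0 is done by hand; there \<open>0 powr a\<close> is 0 even for
    \<open>a = 0\<close>.\<close>
  proof (cases "x = 0")
    case True
    have "y powr (a + 1) = y * y powr a"
      using xy by (simp add: powr_add)
    then show ?thesis
      using True xy a by (auto simp: divide_simps mult_left_mono)
  next
    case False
    have "\<exists>z. x < z \<and> z < y \<and> y powr (a + 1) / (a + 1) - x powr (a + 1) / (a + 1) = (y - x) * z powr a"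
    proof (rule MVT2[OF xy(2)])
      fix z assume "x \<le> z" "z \<le> y"
      then show "((\<lambda>z. z powr (a + 1) / (a + 1)) has_real_derivative z powr a) (at z)"
        using False xy a by (auto intro!: derivative_eq_intros)
    qed
    then obtain z where z: "x < z" "z < y"
      "(y powr (a + 1) - x powr (a + 1)) / (a + 1) = (y - x) * z powr a"
      by (auto simp: diff_divide_distrib)
    moreover have "x powr a \<le> z powr a" "z powr a \<le> y powr a"
      using z xy a by (auto intro!: powr_mono2)
    ultimately show ?thesis
      using xy by (auto intro!: mult_left_mono)
  qed
  then show "(y - x) * x powr a \<le> (y powr (a + 1) - x powr (a + 1)) / (a + 1)"
    "(y powr (a + 1) - x powr (a + 1)) / (a + 1) \<le> (y - x) * y powr a"
    by auto
qed

text \<open>The antiderivative telescopes over the grid, and on each cell its increment lies between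
  the left and the right rectangle because the power is increasing.\<close>

lemma powr_riemann_sums:
  fixes a :: real
  assumes a: "0 \<le> a" and m: "0 < m"
  shows "(\<Sum>k<m. 1 / real m * (real k / real m) powr a) \<le> 1 / (a + 1)"
    and "1 / (a + 1) \<le> (\<Sum>k<m. 1 / real m * (real (Suc k) / real m) powr a)"
proof -
  define F where "F k = (real k / real m) powr (a + 1) / (a + 1)" for k
  have "(\<Sum>k<m. F (Suc k) - F k) = F m - F 0"
    by (rule sum_lessThan_telescope)
  then have tel: "(\<Sum>k<m. F (Suc k) - F k) = 1 / (a + 1)"
    using m by (simp add: F_def)
  have "1 / real m * (real k / real m) powr a \<le> F (Suc k) - F k"
    "F (Suc k) - F k \<le> 1 / real m * (real (Suc k) / real m) powr a" for k
  proof -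
    have "real (Suc k) / real m - real k / real m = 1 / real m"
      by (simp add: diff_divide_distrib[symmetric])
    then show "1 / real m * (real k / real m) powr a \<le> F (Suc k) - F k"
      "F (Suc k) - F k \<le> 1 / real m * (real (Suc k) / real m) powr a"
      using powr_increment_bounds[OF a, of "real k / real m" "real (Suc k) / real m"] m
      unfolding F_def by (simp_all add: diff_divide_distrib divide_strict_right_mono)
  qed
  then show "(\<Sum>k<m. 1 / real m * (real k / real m) powr a) \<le> 1 / (a + 1)"
    "1 / (a + 1) \<le> (\<Sum>k<m. 1 / real m * (real (Suc k) / real m) powr a)"
    unfolding tel[symmetric] by (auto intro!: sum_mono)
qed

text \<open>All geometry is removed: \<open>T\<close> stands for the largest eavesdropper gain and
  \<open>\<gamma> j\<close> for the legitimate gains. In \<open>joint\<close> the levels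
  \<open>t\<close> and \<open>t'\<close> differ because the proof pairs the events
  \<open>T \<le> t\<close> at one quantile with the counts above a neighbouring one.\<close>

locale poisson_race = prob_space M for M :: "'a measure" +
  fixes T :: "'a \<Rightarrow> real" and \<gamma> :: "nat \<Rightarrow> 'a \<Rightarrow> real" and G :: "real \<Rightarrow> ennreal"
    and lam_l lam_e :: real
  assumes rates: "0 < lam_l" "0 < lam_e"
    and T_measurable [measurable]: "T \<in> borel_measurable M"
    and \<gamma>_measurable [measurable]: "\<And>j. \<gamma> j \<in> borel_measurable M"
    and T_pos: "AE \<omega> in M. 0 < T \<omega>"
    and T_no_atom: "\<And>t. AE \<omega> in M. T \<omega> \<noteq> t"
    and prob_T_le: "\<And>t. 0 < t \<Longrightarrow> prob {\<omega> \<in> space M. T \<omega> \<le> t} = exp_neg (ennreal lam_e * G t)"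
    and joint: "\<And>t t' s. 0 < t \<Longrightarrow> 0 < t' \<Longrightarrow> 0 < s \<Longrightarrow> s < 1 \<Longrightarrow>
      expectation (\<lambda>\<omega>. indicator {\<omega> \<in> space M. T \<omega> \<le> t} \<omega> * card_power s {j. t' < \<gamma> j \<omega>}) =
      exp_neg (ennreal lam_e * G t) * exp_neg (ennreal ((1 - s) * lam_l) * G t')"
begin

lemma measurable_card_power_gt [measurable]:
  assumes [measurable]: "U \<in> borel_measurable M" and s: "0 \<le> s" "s < 1"
  shows "(\<lambda>\<omega>. card_power s {j. U \<omega> < \<gamma> j \<omega>}) \<in> borel_measurable M"
proof (rule borel_measurable_LIMSEQ_real[OF tendsto_card_power[OF s]])
  show "(\<lambda>\<omega>. \<Prod>j<n. if j \<in> {j. U \<omega> < \<gamma> j \<omega>} then s else 1) \<in> borel_measurable M" for n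
    by simp
qed

lemma integrable_card_power_gt:
  assumes [measurable]: "U \<in> borel_measurable M" and s: "0 \<le> s" "s < 1"
  shows "integrable M (\<lambda>\<omega>. card_power s {j. U \<omega> < \<gamma> j \<omega>})"
  using s card_power_bounds[of s] by (intro integrable_const_bound[of _ 1]) auto

text \<open>Without atoms the distribution function is continuous and takes every intermediate
  value; positivity of \<open>T\<close> makes it vanish at 0, which forces the quantile to be
  positive.\<close>

lemma quantile:
  assumes x: "0 < x" "x < 1"
  obtains t where "0 < t" "prob {\<omega> \<in> space M. T \<omega> \<le> t} = x"
proof -
  interpret D: prob_space "distr M borel T" by (rule prob_space_distr) simp
  interpret D: real_distribution "distr M borel T" by unfold_locales auto
  have cdf: "cdf (distr M borel T) t = prob {\<omega> \<in> space M. T \<omega> \<le> t}" for t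
    by (simp add: cdf_def measure_distr vimage_def Int_def conj_commute)
  have "measure (distr M borel T) {t} = 0" for t
  proof -
    have "prob {\<omega> \<in> space M. T \<omega> = t} = 0"
      using T_no_atom[of t] by (subst prob_eq_0) auto
    then show ?thesis
      by (simp add: measure_distr vimage_def Int_def conj_commute)
  qed
  then have cont: "isCont (cdf (distr M borel T)) t" for t
    by (simp add: D.isCont_cdf)
  have "eventually (\<lambda>t. x < cdf (distr M borel T) t) at_top"
    using D.cdf_lim_at_top_prob x by (auto dest: order_tendstoD(1))
  then obtain b where b: "0 \<le> b" "x < cdf (distr M borel T) b"
    using eventually_ge_at_top[of "0::real"] eventually_happens[OF eventually_conj] by fastforce
  have zero: "cdf (distr M borel T) t = 0" if "t \<le> 0" for t
    unfolding cdf using T_pos that by (subst prob_eq_0) auto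
  have "\<exists>t\<ge>0. t \<le> b \<and> cdf (distr M borel T) t = x"
    using b x zero[of 0] cont by (intro IVT) auto
  then obtain t where "0 \<le> t" "cdf (distr M borel T) t = x" by blast
  moreover have "t \<noteq> 0" using zero[of t] calculation x by auto
  ultimately show thesis by (intro that[of t]) (auto simp: cdf)
qed

text \<open>The marginal of \<open>joint\<close>: let \<open>t\<close> run to infinity along the
  integers. The first factor tends to 1 because it is the probability of \<open>T \<le> t\<close>,
  so nothing has to be known about \<open>G\<close> at infinity.\<close>

lemma expectation_card_power_gt:
  assumes t': "0 < t'" and s: "0 < s" "s < 1"
  shows "expectation (\<lambda>\<omega>. card_power s {j. t' < \<gamma> j \<omega>}) = exp_neg (ennreal ((1 - s) * lam_l) * G t')"
proof -
  define A where "A n = {\<omega> \<in> space M. T \<omega> \<le> real (Suc n)}" for n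
  have [measurable]: "A n \<in> sets M" for n by (simp add: A_def)
  have ind: "(\<lambda>n. indicator (A n) \<omega> :: real) \<longlonglongrightarrow> 1" if "\<omega> \<in> space M" for \<omega>
  proof (rule tendsto_eventually)
    obtain k where "T \<omega> \<le> real k" using real_arch_simple by blast
    show "eventually (\<lambda>n. indicator (A n) \<omega> = (1::real)) sequentially"
      using eventually_ge_at_top[of k]
    proof eventually_elim
      case (elim n)
      then show ?case using \<open>T \<omega> \<le> real k\<close> that by (auto simp: A_def indicator_def)
    qed
  qed
  have "(\<lambda>n. expectation (\<lambda>\<omega>. indicator (A n) \<omega> :: real)) \<longlonglongrightarrow> expectation (\<lambda>\<omega>. 1)"
    by (rule integral_dominated_convergence[where w="\<lambda>_. 1"]) (auto simp: ind)
  then have 1: "(\<lambda>n. prob (A n)) \<longlonglongrightarrow> 1"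
    by (simp add: prob_space)
  have "(\<lambda>n. expectation (\<lambda>\<omega>. indicator (A n) \<omega> * card_power s {j. t' < \<gamma> j \<omega>}))
      \<longlonglongrightarrow> expectation (\<lambda>\<omega>. card_power s {j. t' < \<gamma> j \<omega>})"
  proof (rule integral_dominated_convergence[where w="\<lambda>_. 1"])
    show "AE \<omega> in M. (\<lambda>n. indicator (A n) \<omega> * card_power s {j. t' < \<gamma> j \<omega>})
        \<longlonglongrightarrow> card_power s {j. t' < \<gamma> j \<omega>}"
    proof (rule AE_I2)
      fix \<omega> assume "\<omega> \<in> space M"
      then show "(\<lambda>n. indicator (A n) \<omega> * card_power s {j. t' < \<gamma> j \<omega>})
        \<longlonglongrightarrow> card_power s {j. t' < \<gamma> j \<omega>}"
        using tendsto_mult[OF ind tendsto_const] by fastforce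
    qed
    show "AE \<omega> in M. norm (indicator (A n) \<omega> * card_power s {j. t' < \<gamma> j \<omega>}) \<le> 1" for n
      using card_power_bounds[of s] s by (auto simp: indicator_def)
  qed (use s in auto)
  moreover have "expectation (\<lambda>\<omega>. indicator (A n) \<omega> * card_power s {j. t' < \<gamma> j \<omega>})
      = prob (A n) * exp_neg (ennreal ((1 - s) * lam_l) * G t')" for n
    using joint[of "real (Suc n)", OF _ t' s] prob_T_le[of "real (Suc n)"] by (simp add: A_def)
  ultimately have "(\<lambda>n. prob (A n) * exp_neg (ennreal ((1 - s) * lam_l) * G t'))
      \<longlonglongrightarrow> expectation (\<lambda>\<omega>. card_power s {j. t' < \<gamma> j \<omega>})"
    by simp
  from LIMSEQ_unique[OF this tendsto_mult[OF 1 tendsto_const]] show ?thesis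
    by simp
qed

text \<open>Positivity of the right-hand base forces \<open>g\<close> to be finite, and then both
  sides are real exponentials.\<close>

lemma exp_neg_rescale:
  assumes c: "0 \<le> c" and x: "0 < exp_neg (ennreal lam_e * g)"
  shows "exp_neg (ennreal c * g) = exp_neg (ennreal lam_e * g) powr (c / lam_e)"
proof -
  have "ennreal lam_e * g \<noteq> \<top>"
    using x by (auto simp: exp_neg_def split: if_splits)
  then have "g \<noteq> \<top>"
    using rates by (auto simp: ennreal_mult_eq_top_iff)
  then obtain r where r: "g = ennreal r" "0 \<le> r"
    by (cases g) auto
  then show ?thesis
    using c rates by (simp add: ennreal_mult'[symmetric] powr_def)
qed

text \<open>
  The generating function of the count above \<open>t\<close> is a power of \<open>prob {T \<le> t}\<close>, so conditioning
  on a grid of quantiles of \<open>T\<close> bounds the expectation by Riemann sums of that power.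
\<close>

lemma expectation_card_power_winners:
  assumes s: "0 < s" "s < 1"
  shows "expectation (\<lambda>\<omega>. card_power s {j. T \<omega> < \<gamma> j \<omega>}) = lam_e / (lam_e + (1 - s) * lam_l)"
proof -
  define a where "a = (1 - s) * lam_l / lam_e"
  have a: "0 < a" using s rates by (simp add: a_def)
  define R where "R \<omega> = card_power s {j. T \<omega> < \<gamma> j \<omega>}" for \<omega>
  have R_int[simp]: "integrable M R"
    unfolding R_def using s by (intro integrable_card_power_gt) auto
  \<comment> \<open>The error \<open>1 / m\<close> is the gap between the upper and the lower
    Riemann sum on the grid of \<open>m\<close> cells.\<close>
  have approx: "\<bar>expectation R - 1 / (a + 1)\<bar> \<le> 1 / real m" if m: "0 < m" for m
  proof -
    have "\<exists>t>0. prob {\<omega> \<in> space M. T \<omega> \<le> t} = real k / real m" if k: "0 < k" "k < m" for k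
      using quantile[of "real k / real m"] k by fastforce
    then obtain t where t: "\<And>k. 0 < k \<Longrightarrow> k < m \<Longrightarrow> 0 < t k"
      "\<And>k. 0 < k \<Longrightarrow> k < m \<Longrightarrow> prob {\<omega> \<in> space M. T \<omega> \<le> t k} = real k / real m"
      by metis
    \<comment> \<open>There are no quantiles \<open>t 0\<close> and \<open>t m\<close>. The empty
      set and the whole space replace the events, and the constants 0 and 1 the counts in
      \<open>Y\<close>, in agreement with the values of \<open>(k / m) powr a\<close> at the two
      ends.\<close>
    define A where "A k = (if k = 0 then {} else if k < m then {\<omega> \<in> space M. T \<omega> \<le> t k} else space M)" for k
    define Y where "Y k \<omega> = (if k = 0 then 0 else if k < m then card_power s {j. t k < \<gamma> j \<omega>} else 1)" for k \<omega>
    have [measurable]: "A k \<in> sets M" for k by (simp add: A_def)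
    have [measurable]: "Y k \<in> borel_measurable M" for k
      using s by (cases "k = 0"; cases "k < m") (auto simp: Y_def[abs_def])
    have Y_bd: "0 \<le> Y k \<omega>" "Y k \<omega> \<le> 1" for k \<omega>
      using card_power_bounds[of s] s by (auto simp: Y_def)
    have AY_int[simp]: "integrable M (\<lambda>\<omega>. indicator (A k) \<omega> * Y l \<omega>)" for k l
      using Y_bd by (intro integrable_const_bound[of _ 1]) (auto simp: indicator_def)
    have AY: "expectation (\<lambda>\<omega>. indicator (A k) \<omega> * Y l \<omega>) = real k / real m * (real l / real m) powr a"
      if kl: "k \<le> m" "l \<le> m" for k l
    proof -
      have le: "exp_neg (ennreal lam_e * G (t i)) = real i / real m" if "0 < i" "i < m" for i
        using t[OF that] prob_T_le by simp
      have ll: "exp_neg (ennreal ((1 - s) * lam_l) * G (t i)) = (real i / real m) powr a"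
        if "0 < i" "i < m" for i
        using exp_neg_rescale[of "(1 - s) * lam_l" "G (t i)"] le[OF that] that s rates
        by (simp add: a_def)
      \<comment> \<open>Only the third case needs \<open>joint\<close>, the fifth its marginal; in
        the others at least one factor is a boundary constant.\<close>
      consider "k = 0" | "l = 0" | "0 < k" "k < m" "0 < l" "l < m" | "0 < k" "k < m" "l = m"
        | "k = m" "0 < l" "l < m" | "k = m" "l = m" "0 < m"
        using kl m by linarith
      then show ?thesis
      proof cases
        case 3
        then show ?thesis
          using joint[OF t(1) t(1) s, of k l] by (simp add: A_def Y_def le ll)
      next
        case 4
        then show ?thesis using t(2)[of k] by (simp add: A_def Y_def)
      next
        case 5
        then have "expectation (\<lambda>\<omega>. indicator (A k) \<omega> * Y l \<omega>) =
            expectation (\<lambda>\<omega>. card_power s {j. t l < \<gamma> j \<omega>})"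
          by (intro Bochner_Integration.integral_cong) (auto simp: A_def Y_def)
        then show ?thesis
          using 5 expectation_card_power_gt[OF t(1) s, of l] ll by simp
      next
        case 6
        then show ?thesis by (simp add: A_def Y_def prob_space)
      qed (simp_all add: A_def Y_def)
    qed
    have A_mono: "A k \<subseteq> A (Suc k)" for k
    proof (cases "0 < k \<and> Suc k < m")
      case True
      \<comment> \<open>The quantiles were chosen independently of each other; their order is
        recovered from the probabilities.\<close>
      have "t k \<le> t (Suc k)"
      proof (rule ccontr)
        assume "\<not> t k \<le> t (Suc k)"
        then have "prob {\<omega> \<in> space M. T \<omega> \<le> t (Suc k)} \<le> prob {\<omega> \<in> space M. T \<omega> \<le> t k}"
          by (intro finite_measure_mono) auto
        then show False
          using t(2)[of k] t(2)[of "Suc k"] True by (simp add: divide_simps split: if_splits)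
      qed
      then show ?thesis using True by (auto simp: A_def)
    qed (auto simp: A_def)
    \<comment> \<open>On this cell \<open>T\<close> lies above \<open>t k\<close> and not above
      \<open>t (Suc k)\<close>, and raising the threshold shrinks the set of winners.\<close>
    have bounds: "Y k \<omega> \<le> R \<omega>" "R \<omega> \<le> Y (Suc k) \<omega>"
      if "\<omega> \<in> A (Suc k) - A k" for k \<omega>
      using that s card_power_bounds[of s]
      by (auto simp: A_def Y_def R_def intro!: card_power_antimono split: if_splits)
    \<comment> \<open>The cells partition the space: the differences of indicators telescope from
      the empty set to the whole space.\<close>
    have R_eq: "R \<omega> = (\<Sum>k<m. (indicator (A (Suc k)) \<omega> - indicator (A k) \<omega>) * R \<omega>)"
      if "\<omega> \<in> space M" for \<omega>
      using m that sum_lessThan_telescope[of "\<lambda>k. indicator (A k) \<omega> :: real" m]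
      by (simp add: sum_distrib_right[symmetric]) (simp add: A_def)
    have lower: "(\<Sum>k<m. (indicator (A (Suc k)) \<omega> - indicator (A k) \<omega>) * Y k \<omega>) \<le> R \<omega>"
      and upper: "R \<omega> \<le> (\<Sum>k<m. (indicator (A (Suc k)) \<omega> - indicator (A k) \<omega>) * Y (Suc k) \<omega>)"
      if "\<omega> \<in> space M" for \<omega>
      using A_mono bounds[of \<omega>]
      by (subst R_eq[OF that], intro sum_mono, auto simp: indicator_def)+
    have E: "expectation (\<lambda>\<omega>. \<Sum>k<m. (indicator (A (Suc k)) \<omega> - indicator (A k) \<omega>) * Y (f k) \<omega>)
        = (\<Sum>k<m. 1 / real m * (real (f k) / real m) powr a)" if f: "\<And>k. k < m \<Longrightarrow> f k \<le> m" for f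
      by (simp add: left_diff_distrib AY f diff_divide_distrib[symmetric] del: of_nat_Suc)
         (intro sum.cong refl, simp add: field_simps)
    have "expectation (\<lambda>\<omega>. \<Sum>k<m. (indicator (A (Suc k)) \<omega> - indicator (A k) \<omega>) * Y k \<omega>) \<le> expectation R"
      using lower by (intro integral_mono) (auto simp: left_diff_distrib)
    then have L: "(\<Sum>k<m. 1 / real m * (real k / real m) powr a) \<le> expectation R"
      using E[of "\<lambda>k. k"] by simp
    have "expectation R \<le> expectation (\<lambda>\<omega>. \<Sum>k<m. (indicator (A (Suc k)) \<omega> - indicator (A k) \<omega>) * Y (Suc k) \<omega>)"
      using upper by (intro integral_mono) (auto simp: left_diff_distrib)
    then have U: "expectation R \<le> (\<Sum>k<m. 1 / real m * (real (Suc k) / real m) powr a)"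
      using E[of Suc] by simp
    \<comment> \<open>The right sum minus the left sum telescopes to \<open>1 / m\<close> times the
      increment of the power from 0 to 1.\<close>
    have "(\<Sum>k<m. 1 / real m * (real (Suc k) / real m) powr a)
        - (\<Sum>k<m. 1 / real m * (real k / real m) powr a) = 1 / real m"
    proof -
      have "(\<Sum>k<m. (real (Suc k) / real m) powr a - (real k / real m) powr a) = 1"
        using m a by (subst sum_lessThan_telescope) simp
      then show ?thesis
        by (simp only: sum_subtractf[symmetric] right_diff_distrib[symmetric] sum_distrib_left[symmetric])
    qed
    then show ?thesis
      using L U powr_riemann_sums[of a m] a m by linarith
  qed
  have "(\<lambda>m. 1 / real (Suc m)) \<longlonglongrightarrow> 0"
    using LIMSEQ_inverse_real_of_nat by (simp add: inverse_eq_divide)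
  then have "\<bar>expectation R - 1 / (a + 1)\<bar> \<le> 0"
    by (rule LIMSEQ_le_const) (auto intro!: exI[of _ 0] approx simp del: of_nat_Suc)
  moreover have "1 / (a + 1) = lam_e / (lam_e + (1 - s) * lam_l)"
    using rates by (simp add: a_def field_simps)
  ultimately show ?thesis by (simp add: R_def[abs_def])
qed

text \<open>There are only countably many finite sets of indices, and for each of them being the set
  of winners is a countable intersection of events.\<close>

lemma sets_card_winners [measurable]:
  "{\<omega> \<in> space M. finite {j. T \<omega> < \<gamma> j \<omega>} \<and> card {j. T \<omega> < \<gamma> j \<omega>} = n} \<in> sets M"
proof -
  have "{\<omega> \<in> space M. finite {j. T \<omega> < \<gamma> j \<omega>} \<and> card {j. T \<omega> < \<gamma> j \<omega>} = n} =
      (\<Union>F\<in>{F. finite F \<and> card F = n}. {\<omega> \<in> space M. \<forall>j. j \<in> F \<longleftrightarrow> T \<omega> < \<gamma> j \<omega>})"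
  proof (intro equalityI subsetI)
    fix \<omega> assume "\<omega> \<in> {\<omega> \<in> space M. finite {j. T \<omega> < \<gamma> j \<omega>} \<and> card {j. T \<omega> < \<gamma> j \<omega>} = n}"
    then show "\<omega> \<in> (\<Union>F\<in>{F. finite F \<and> card F = n}. {\<omega> \<in> space M. \<forall>j. j \<in> F \<longleftrightarrow> T \<omega> < \<gamma> j \<omega>})"
      by (intro UN_I[of "{j. T \<omega> < \<gamma> j \<omega>}"]) auto
  next
    fix \<omega> assume "\<omega> \<in> (\<Union>F\<in>{F. finite F \<and> card F = n}. {\<omega> \<in> space M. \<forall>j. j \<in> F \<longleftrightarrow> T \<omega> < \<gamma> j \<omega>})"
    then obtain F where F: "\<omega> \<in> space M" "finite F" "card F = n" "\<forall>j. j \<in> F \<longleftrightarrow> T \<omega> < \<gamma> j \<omega>"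
      by auto
    then have "{j. T \<omega> < \<gamma> j \<omega>} = F" by auto
    then show "\<omega> \<in> {\<omega> \<in> space M. finite {j. T \<omega> < \<gamma> j \<omega>} \<and> card {j. T \<omega> < \<gamma> j \<omega>} = n}"
      using F by simp
  qed
  also have "\<dots> \<in> sets M"
  proof (rule sets.countable_UN'')
    show "countable {F::nat set. finite F \<and> card F = n}"
      by (rule countable_subset[OF _ countable_Collect_finite]) auto
  qed measurable
  finally show ?thesis .
qed

text \<open>The generating function of the count agrees on the open unit interval with that of the
  geometric law, infinite counts contributing 0 to it; comparing coefficients gives the
  probabilities.\<close>

theorem prob_card_winners:
  "prob {\<omega> \<in> space M. finite {j. T \<omega> < \<gamma> j \<omega>} \<and> card {j. T \<omega> < \<gamma> j \<omega>} = n} =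
    (lam_l / (lam_l + lam_e)) ^ n * (lam_e / (lam_l + lam_e))"
proof -
  define J where "J \<omega> = {j. T \<omega> < \<gamma> j \<omega>}" for \<omega>
  define W where "W n = {\<omega> \<in> space M. finite (J \<omega>) \<and> card (J \<omega>) = n}" for n
  define x where "x = lam_l / (lam_l + lam_e)"
  have x: "0 < x" "x < 1" "1 - x = lam_e / (lam_l + lam_e)"
    using rates by (auto simp: x_def field_simps)
  have W[measurable]: "W n \<in> sets M" for n
    by (simp add: W_def J_def)
  have pgf: "(\<lambda>n. prob (W n) * s ^ n) sums (lam_e / (lam_e + (1 - s) * lam_l))"
    if s: "0 < s" "s < 1" for s
  proof -
    have sm: "summable (\<lambda>n. prob (W n) * s ^ n)"
      using s by (intro summable_comparison_test[OF _ summable_geometric[of s]])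
        (auto intro!: exI[of _ 0] mult_left_le_one_le)
    have "ennreal (expectation (\<lambda>\<omega>. card_power s (J \<omega>))) = (\<integral>\<^sup>+\<omega>. ennreal (card_power s (J \<omega>)) \<partial>M)"
      using s integrable_card_power_gt[of T s] card_power_bounds[of s]
      by (intro nn_integral_eq_integral[symmetric]) (auto simp: J_def)
    also have "\<dots> = (\<integral>\<^sup>+\<omega>. (\<Sum>k. ennreal (s ^ k) * indicator (W k) \<omega>) \<partial>M)"
    proof (rule nn_integral_cong)
      fix \<omega> assume \<omega>: "\<omega> \<in> space M"
      show "ennreal (card_power s (J \<omega>)) = (\<Sum>k. ennreal (s ^ k) * indicator (W k) \<omega>)"
      proof (cases "finite (J \<omega>)")
        case True
        then have "(\<lambda>k. ennreal (s ^ k) * indicator (W k) \<omega>)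
            = (\<lambda>k. if k = card (J \<omega>) then ennreal (s ^ k) else 0)"
          using \<omega> by (auto simp: W_def indicator_def)
        then show ?thesis
          using sums_single[of "card (J \<omega>)" "\<lambda>k. ennreal (s ^ k)"] True
          by (simp add: sums_iff card_power_def)
      qed (simp add: card_power_def W_def)
    qed
    also have "\<dots> = (\<Sum>k. ennreal (s ^ k) * emeasure M (W k))"
      by (subst nn_integral_suminf) (auto simp: nn_integral_cmult_indicator)
    also have "\<dots> = (\<Sum>k. ennreal (prob (W k) * s ^ k))"
      using s by (intro suminf_cong) (simp add: emeasure_eq_measure ennreal_mult'[symmetric] mult.commute)
    also have "\<dots> = ennreal (\<Sum>k. prob (W k) * s ^ k)"
      using s sm by (intro suminf_ennreal_eq) (auto intro: summable_sums)
    finally have "expectation (\<lambda>\<omega>. card_power s (J \<omega>)) = (\<Sum>k. prob (W k) * s ^ k)"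
      using s card_power_bounds[of s] sm by (subst (asm) ennreal_inj) (auto intro!: suminf_nonneg)
    then show ?thesis
      using expectation_card_power_winners[OF s] summable_sums[OF sm] by (simp add: J_def)
  qed
  have geo: "(\<lambda>n. (x ^ n * (1 - x)) * s ^ n) sums (lam_e / (lam_e + (1 - s) * lam_l))"
    if s: "0 < s" "s < 1" for s
  proof -
    have "x * s < 1 * 1" using x s by (intro mult_strict_mono) auto
    then have "x * s < 1" by simp
    then have "(\<lambda>n. (1 - x) * (x * s) ^ n) sums ((1 - x) * (1 / (1 - x * s)))"
      using x s by (intro sums_mult geometric_sums) auto
    moreover have "(1 - x) * (1 / (1 - x * s)) = lam_e / (lam_e + (1 - s) * lam_l)"
    proof -
      have "lam_l + lam_e - lam_l * s = lam_e + (1 - s) * lam_l" by (simp add: algebra_simps)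
      moreover have "0 < lam_e + (1 - s) * lam_l" using rates s by (simp add: add_pos_pos)
      moreover have "1 - x * s = (lam_l + lam_e - lam_l * s) / (lam_l + lam_e)"
        using rates by (simp add: x_def diff_divide_distrib)
      ultimately show ?thesis using rates unfolding x(3) by simp
    qed
    ultimately show ?thesis by (simp add: power_mult_distrib mult_ac)
  qed
  have "prob (W n) - x ^ n * (1 - x) = 0"
  proof (rule power_series_zero_imp_coeff_zero[where c = "\<lambda>n. prob (W n) - x ^ n * (1 - x)"])
    fix n
    have "0 \<le> x ^ n * (1 - x)" "x ^ n * (1 - x) \<le> 1"
      using x(1,2) by (auto intro!: mult_le_one power_le_one mult_nonneg_nonneg)
    then show "\<bar>prob (W n) - x ^ n * (1 - x)\<bar> \<le> 1"
      using prob_le_1[of "W n"] measure_nonneg[of M "W n"] by linarith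
  next
    fix s :: real assume "0 < s" "s < 1"
    from sums_diff[OF pgf[OF this] geo[OF this]]
    show "(\<lambda>n. (prob (W n) - x ^ n * (1 - x)) * s ^ n) sums 0"
      by (simp add: left_diff_distrib)
  qed
  then show ?thesis
    by (simp add: W_def J_def x(3)) (simp add: x_def)
qed

end

section \<open>Independent marks\<close>

text \<open>Independence of the generated sigma-algebras makes the joint law a product measure,
  already determined on rectangles; the rest is Fubini. Freezing the first variable serves to
  average over the marks, freezing the second to rule out atoms.\<close>

lemma (in prob_space)
  assumes X [measurable]: "X \<in> measurable M S" and Y [measurable]: "Y \<in> measurable M T"
    and indep: "indep_set (sets (vimage_algebra (space M) X S)) (sets (vimage_algebra (space M) Y T))"
    and F [measurable]: "F \<in> borel_measurable (S \<Otimes>\<^sub>M T)"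
  shows nn_integral_indep_set: "(\<integral>\<^sup>+\<omega>. F (X \<omega>, Y \<omega>) \<partial>M) = (\<integral>\<^sup>+\<omega>. \<integral>\<^sup>+\<omega>'. F (X \<omega>, Y \<omega>') \<partial>M \<partial>M)"
    and nn_integral_indep_set': "(\<integral>\<^sup>+\<omega>. F (X \<omega>, Y \<omega>) \<partial>M) = (\<integral>\<^sup>+\<omega>'. \<integral>\<^sup>+\<omega>. F (X \<omega>, Y \<omega>') \<partial>M \<partial>M)"
proof -
  interpret DX: prob_space "distr M S X" by (rule prob_space_distr) simp
  interpret DY: prob_space "distr M T Y" by (rule prob_space_distr) simp
  interpret DXY: pair_prob_space "distr M S X" "distr M T Y" ..
  have eq: "distr M S X \<Otimes>\<^sub>M distr M T Y = distr M (S \<Otimes>\<^sub>M T) (\<lambda>\<omega>. (X \<omega>, Y \<omega>))"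
  proof (rule pair_measure_eqI)
    fix A B assume "A \<in> sets (distr M S X)" "B \<in> sets (distr M T Y)"
    then have AB[measurable]: "A \<in> sets S" "B \<in> sets T" by auto
    have "prob ((X -` A \<inter> space M) \<inter> (Y -` B \<inter> space M)) = prob (X -` A \<inter> space M) * prob (Y -` B \<inter> space M)"
      by (rule indep_setD[OF indep]) (auto intro: in_vimage_algebra)
    moreover have "(\<lambda>\<omega>. (X \<omega>, Y \<omega>)) -` (A \<times> B) \<inter> space M = (X -` A \<inter> space M) \<inter> (Y -` B \<inter> space M)"
      by auto
    ultimately show "emeasure (distr M S X) A * emeasure (distr M T Y) B =
        emeasure (distr M (S \<Otimes>\<^sub>M T) (\<lambda>\<omega>. (X \<omega>, Y \<omega>))) (A \<times> B)"
      by (simp add: emeasure_distr emeasure_eq_measure ennreal_mult'[symmetric])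
  qed (auto intro: DX.sigma_finite_measure_axioms DY.sigma_finite_measure_axioms cong: sets_pair_measure_cong)
  have "(\<integral>\<^sup>+\<omega>. F (X \<omega>, Y \<omega>) \<partial>M) = (\<integral>\<^sup>+p. F p \<partial>(distr M S X \<Otimes>\<^sub>M distr M T Y))"
    unfolding eq by (simp add: nn_integral_distr)
  also have "\<dots> = (\<integral>\<^sup>+x. \<integral>\<^sup>+y. F (x, y) \<partial>distr M T Y \<partial>distr M S X)"
    by (subst DY.nn_integral_fst) simp_all
  finally have *: "(\<integral>\<^sup>+\<omega>. F (X \<omega>, Y \<omega>) \<partial>M) = (\<integral>\<^sup>+x. \<integral>\<^sup>+y. F (x, y) \<partial>distr M T Y \<partial>distr M S X)" .
  then show "(\<integral>\<^sup>+\<omega>. F (X \<omega>, Y \<omega>) \<partial>M) = (\<integral>\<^sup>+\<omega>. \<integral>\<^sup>+\<omega>'. F (X \<omega>, Y \<omega>') \<partial>M \<partial>M)"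
    by (subst (asm) nn_integral_distr, simp, simp add: DY.borel_measurable_nn_integral)
       (simp add: nn_integral_distr cong: nn_integral_cong)
  have "(\<integral>\<^sup>+x. \<integral>\<^sup>+y. F (x, y) \<partial>distr M T Y \<partial>distr M S X) = (\<integral>\<^sup>+y. \<integral>\<^sup>+x. F (x, y) \<partial>distr M S X \<partial>distr M T Y)"
    by (rule DXY.Fubini'[symmetric]) (simp add: case_prod_eta)
  then show "(\<integral>\<^sup>+\<omega>. F (X \<omega>, Y \<omega>) \<partial>M) = (\<integral>\<^sup>+\<omega>'. \<integral>\<^sup>+\<omega>. F (X \<omega>, Y \<omega>') \<partial>M \<partial>M)"
    unfolding * by (simp add: nn_integral_distr DX.borel_measurable_nn_integral cong: nn_integral_cong)
qed

text \<open>
  The value for \<open>i = j\<close> is junk, chosen inside \<^const>\<open>links\<close> so that every label denotes a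
  random variable.
\<close>

definition pair_label :: "nat \<Rightarrow> nat \<Rightarrow> nat \<times> nat + nat \<times> nat" where
  "pair_label i j = Inl (if i = j then (0, 1) else (min i j, max i j))"

lemma pair_label_in_links [simp]: "pair_label i j \<in> links"
  by (auto simp: pair_label_def links_def)

lemma Inr_in_links [simp]: "Inr p \<in> links"
  by (simp add: links_def)

text \<open>The random place of the typical node in the enumeration. It is a function of the
  positions alone, hence it can be frozen together with them.\<close>

definition origin_index :: "(nat \<Rightarrow> plane) \<Rightarrow> nat" where
  "origin_index l = (LEAST i. l i = 0)"

lemma measurable_origin_index [measurable]:
  "origin_index \<in> measurable (PiM UNIV (\<lambda>_. borel)) (count_space UNIV)"
  unfolding origin_index_def by measurable

text \<open>\<open>K\<close> abstracts from \<open>link_effect\<close>: an i.i.d. family of labelled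
  variables, independent of the enumerations, with some common law \<open>\<nu>\<close>. No density
  is assumed at this level.\<close>

locale marked_poisson = prob_space M for M :: "'w measure" +
  fixes L E :: "nat \<Rightarrow> 'w \<Rightarrow> plane" and K :: "nat \<times> nat + nat \<times> nat \<Rightarrow> 'w \<Rightarrow> real"
    and \<nu> :: "real measure" and \<Phi>l \<Phi>e :: "'w \<Rightarrow> plane set" and lam_l lam_e :: real
  assumes rates: "0 < lam_l" "0 < lam_e"
    and L_measurable [measurable]: "\<And>i. L i \<in> borel_measurable M"
    and E_measurable [measurable]: "\<And>i. E i \<in> borel_measurable M"
    and K_measurable: "\<And>k. k \<in> links \<Longrightarrow> K k \<in> borel_measurable M"
    and K_distr: "\<And>k. k \<in> links \<Longrightarrow> distr M lborel (K k) = \<nu>"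
    and K_indep: "indep_vars (\<lambda>_. borel) K links"
    and LE_K_indep: "indep_set
      (sets (vimage_algebra (space M) (\<lambda>\<omega>. ((\<lambda>i. L i \<omega>), (\<lambda>j. E j \<omega>)))
         (PiM UNIV (\<lambda>_. borel) \<Otimes>\<^sub>M PiM UNIV (\<lambda>_. borel))))
      (sets (vimage_algebra (space M) (\<lambda>\<omega>. \<lambda>k\<in>links. K k \<omega>) (PiM links (\<lambda>_. borel))))"
    and L_enum: "AE \<omega> in M. bij_betw (\<lambda>i. L i \<omega>) UNIV (insert 0 (\<Phi>l \<omega>))"
    and E_enum: "AE \<omega> in M. bij_betw (\<lambda>i. E i \<omega>) UNIV (\<Phi>e \<omega>)"
    and poisson_l: "poisson_process M lam_l \<Phi>l"
    and poisson_e: "poisson_process M lam_e \<Phi>e"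
    and processes_indep: "indep_var config_space \<Phi>l config_space \<Phi>e"
begin

lemma K_measurable' [measurable]: "K (pair_label i j) \<in> borel_measurable M" "K (Inr p) \<in> borel_measurable M"
  by (auto intro: K_measurable)

lemma nn_integral_K:
  assumes "k \<in> links" and [measurable]: "\<phi> \<in> borel_measurable borel"
  shows "(\<integral>\<^sup>+\<omega>. \<phi> (K k \<omega>) \<partial>M) = (\<integral>\<^sup>+z. \<phi> z \<partial>\<nu>)"
  using K_measurable[OF assms(1)]
  by (subst K_distr[OF assms(1), symmetric], subst nn_integral_distr) auto

sublocale mark: prob_space \<nu>
  using K_distr[of "Inr (0, 0)"] K_measurable[of "Inr (0, 0)"]
  by (metis Inr_in_links prob_space_distr measurable_lborel1)

lemma sets_\<nu> [measurable_cong, simp]: "sets \<nu> = sets borel"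
  using K_distr[of "Inr (0, 0)"] by (metis Inr_in_links sets_distr sets_lborel)

lemma space_\<nu> [simp]: "space \<nu> = UNIV"
  using sets_eq_imp_space_eq[OF sets_\<nu>] by simp

definition origin :: "'w \<Rightarrow> nat" where
  "origin \<omega> = origin_index (\<lambda>i. L i \<omega>)"

text \<open>The effect on the link from the typical node to point \<open>j\<close>. Its label
  depends on the random \<open>origin\<close>, so it is not itself a member of the i.i.d. family; at
  \<open>j = origin \<omega>\<close> it is the junk variable.\<close>

definition mark_l :: "nat \<Rightarrow> 'w \<Rightarrow> real" where
  "mark_l j \<omega> = K (pair_label (origin \<omega>) j) \<omega>"

definition mark_e :: "nat \<Rightarrow> 'w \<Rightarrow> real" where
  "mark_e j \<omega> = K (Inr (origin \<omega>, j)) \<omega>"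

lemma measurable_L_seq [measurable]: "(\<lambda>\<omega> i. L i \<omega>) \<in> measurable M (PiM UNIV (\<lambda>_. borel))"
  by (rule measurable_PiM_single') auto

lemma measurable_E_seq [measurable]: "(\<lambda>\<omega> i. E i \<omega>) \<in> measurable M (PiM UNIV (\<lambda>_. borel))"
  by (rule measurable_PiM_single') auto

lemma measurable_K_seq [measurable]: "(\<lambda>\<omega>. \<lambda>k\<in>links. K k \<omega>) \<in> measurable M (PiM links (\<lambda>_. borel))"
  by (rule measurable_restrict) (rule K_measurable)

lemma measurable_origin [measurable]: "origin \<in> measurable M (count_space UNIV)"
  unfolding origin_def[abs_def] by measurable

lemma measurable_mark_l [measurable]: "mark_l j \<in> borel_measurable M"
  unfolding mark_l_def[abs_def] by (rule measurable_compose_countable) auto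

lemma measurable_mark_e [measurable]: "mark_e j \<in> borel_measurable M"
  unfolding mark_e_def[abs_def] by (rule measurable_compose_countable[where f="\<lambda>i. K (Inr (i, j))"]) auto

text \<open>With positions and origin index frozen, distinct links carry distinct labels, so the
  mean factors. The index \<open>i\<close> has to be removed first, since its junk label may
  coincide with that of a genuine link; \<open>w2 0 = 1\<close> makes the removal harmless.\<close>

lemma nn_integral_prod_marks:
  assumes w1 [measurable]: "(\<lambda>p. w1 (fst p) (snd p)) \<in> borel_measurable (borel \<Otimes>\<^sub>M borel)"
    and w2 [measurable]: "(\<lambda>p. w2 (fst p) (snd p)) \<in> borel_measurable (borel \<Otimes>\<^sub>M borel)"
    and w2_0: "\<And>z. w2 (0::plane) z = (1::ennreal)" and i: "l i = 0"
  shows "(\<integral>\<^sup>+\<omega>. (\<Prod>j<n. w1 (e j) (K (Inr (i, j)) \<omega>)) * (\<Prod>j<n. w2 (l j) (K (pair_label i j) \<omega>)) \<partial>M) =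
    (\<Prod>j<n. \<integral>\<^sup>+z. w1 (e j :: plane) z \<partial>\<nu>) * (\<Prod>j<n. \<integral>\<^sup>+z. w2 (l j) z \<partial>\<nu>)"
proof -
  have [measurable]: "w1 x \<in> borel_measurable borel" "w2 x \<in> borel_measurable borel" for x
    using measurable_compose[OF measurable_Pair1' w1, of x] measurable_compose[OF measurable_Pair1' w2, of x]
    by auto
  define J where "J = {..<n} - {i}"
  \<comment> \<open>Decodes a label into the weight at its far end: for an unordered pair containing
    \<open>i\<close>, this is the endpoint other than \<open>i\<close>.\<close>
  define \<phi> where "\<phi> k = (case k of Inr (_, j) \<Rightarrow> w1 (e j) | Inl (a, b) \<Rightarrow> w2 (l (if a = i then b else a)))"
    for k :: "nat \<times> nat + nat \<times> nat"
  have [measurable]: "\<phi> k \<in> borel_measurable borel" for k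
    by (cases k) (auto simp: \<phi>_def split: prod.split)
  have \<phi>_l: "\<phi> (pair_label i j) = w2 (l j)" if "j \<in> J" for j
    using that by (auto simp: \<phi>_def pair_label_def J_def min_def max_def)
  have inj_e: "inj_on (\<lambda>j. Inr (i, j) :: nat \<times> nat + nat \<times> nat) {..<n}" by (auto simp: inj_on_def)
  have inj_l: "inj_on (pair_label i) J"
    by (auto simp: inj_on_def J_def pair_label_def min_def max_def split: if_splits)
  define I where "I = (\<lambda>j. Inr (i, j)) ` {..<n} \<union> pair_label i ` J"
  have I: "finite I" "I \<subseteq> links" by (auto simp: I_def J_def)
  have prod_I: "(\<Prod>k\<in>I. H k) = (\<Prod>j<n. H (Inr (i, j))) * (\<Prod>j\<in>J. H (pair_label i j))"
    for H :: "_ \<Rightarrow> ennreal"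
  proof -
    have "(\<Prod>k\<in>I. H k) = (\<Prod>k\<in>(\<lambda>j. Inr (i, j)) ` {..<n}. H k) * (\<Prod>k\<in>pair_label i ` J. H k)"
      unfolding I_def by (rule prod.union_disjoint) (auto simp: J_def pair_label_def)
    then show ?thesis by (simp add: prod.reindex inj_e inj_l)
  qed
  have drop: "(\<Prod>j<n. H j) = (\<Prod>j\<in>J. H j)" if "H i = 1" for H :: "nat \<Rightarrow> ennreal"
    unfolding J_def using that by (intro prod.mono_neutral_right) auto
  have "(\<integral>\<^sup>+\<omega>. (\<Prod>j<n. w1 (e j) (K (Inr (i, j)) \<omega>)) * (\<Prod>j<n. w2 (l j) (K (pair_label i j) \<omega>)) \<partial>M)
      = (\<integral>\<^sup>+\<omega>. (\<Prod>k\<in>I. \<phi> k (K k \<omega>)) \<partial>M)"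
    by (simp add: prod_I drop i w2_0 \<phi>_l cong: prod.cong) (simp add: \<phi>_def)
  also have "\<dots> = (\<Prod>k\<in>I. \<integral>\<^sup>+\<omega>. \<phi> k (K k \<omega>) \<partial>M)"
    by (intro indep_vars_nn_integral I indep_vars_compose2[OF indep_vars_subset[OF K_indep I(2)]]) auto
  also have "\<dots> = (\<Prod>k\<in>I. \<integral>\<^sup>+z. \<phi> k z \<partial>\<nu>)"
    using I(2) by (intro prod.cong refl nn_integral_K) auto
  also have "\<dots> = (\<Prod>j<n. \<integral>\<^sup>+z. w1 (e j) z \<partial>\<nu>) * (\<Prod>j<n. \<integral>\<^sup>+z. w2 (l j) z \<partial>\<nu>)"
  proof -
    have "w2 (l i) = (\<lambda>_. 1)"
      by (simp add: fun_eq_iff i w2_0)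
    then have "(\<integral>\<^sup>+z. w2 (l i) z \<partial>\<nu>) = 1"
      using mark.emeasure_space_1 by simp
    then have "(\<Prod>j<n. \<integral>\<^sup>+z. w2 (l j) z \<partial>\<nu>) = (\<Prod>j\<in>J. \<integral>\<^sup>+z. w2 (l j) z \<partial>\<nu>)"
      by (rule drop)
    then show ?thesis
      by (simp add: prod_I \<phi>_l cong: prod.cong) (simp add: \<phi>_def)
  qed
  finally show ?thesis .
qed

text \<open>Independence of the enumerations from the marks permits integrating over the marks
  first; each weight is then replaced by its \<open>\<nu>\<close>-average at the actual
  position.\<close>

lemma nn_integral_marks:
  assumes w1 [measurable]: "(\<lambda>p. w1 (fst p) (snd p)) \<in> borel_measurable (borel \<Otimes>\<^sub>M borel)"
    and w2 [measurable]: "(\<lambda>p. w2 (fst p) (snd p)) \<in> borel_measurable (borel \<Otimes>\<^sub>M borel)"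
    and w2_0: "\<And>z. w2 (0::plane) z = (1::ennreal)"
  shows "(\<integral>\<^sup>+\<omega>. (\<Prod>j<n. w1 (E j \<omega>) (mark_e j \<omega>)) * (\<Prod>j<n. w2 (L j \<omega>) (mark_l j \<omega>)) \<partial>M) =
    (\<integral>\<^sup>+\<omega>. (\<Prod>j<n. \<integral>\<^sup>+z. w1 (E j \<omega>) z \<partial>\<nu>) * (\<Prod>j<n. \<integral>\<^sup>+z. w2 (L j \<omega>) z \<partial>\<nu>) \<partial>M)"
proof -
  let ?S = "PiM UNIV (\<lambda>_::nat. borel :: plane measure) \<Otimes>\<^sub>M PiM UNIV (\<lambda>_::nat. borel :: plane measure)"
  let ?T = "PiM links (\<lambda>_. borel :: real measure)"
  define F where "F i p = (\<Prod>j<n. w1 (snd (fst p) j) (snd p (Inr (i, j)))) *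
      (\<Prod>j<n. w2 (fst (fst p) j) (snd p (pair_label i j)))"
    for i and p :: "((nat \<Rightarrow> plane) \<times> (nat \<Rightarrow> plane)) \<times> (nat \<times> nat + nat \<times> nat \<Rightarrow> real)"
  have proj: "(\<lambda>p. snd p k) \<in> borel_measurable (?S \<Otimes>\<^sub>M ?T)" if "k \<in> links" for k
    using that by measurable
  have F[measurable]: "F i \<in> borel_measurable (?S \<Otimes>\<^sub>M ?T)" for i
    unfolding F_def[abs_def]
  proof (intro borel_measurable_times_ennreal borel_measurable_prod_ennreal)
    fix j
    have "(\<lambda>p. (snd (fst p) j, snd p (Inr (i, j)))) \<in> measurable (?S \<Otimes>\<^sub>M ?T) (borel \<Otimes>\<^sub>M borel)"
      by (intro measurable_Pair proj) auto
    from measurable_compose[OF this w1]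
    show "(\<lambda>p. w1 (snd (fst p) j) (snd p (Inr (i, j)))) \<in> borel_measurable (?S \<Otimes>\<^sub>M ?T)" by simp
    have "(\<lambda>p. (fst (fst p) j, snd p (pair_label i j))) \<in> measurable (?S \<Otimes>\<^sub>M ?T) (borel \<Otimes>\<^sub>M borel)"
      by (intro measurable_Pair proj) auto
    from measurable_compose[OF this w2]
    show "(\<lambda>p. w2 (fst (fst p) j) (snd p (pair_label i j))) \<in> borel_measurable (?S \<Otimes>\<^sub>M ?T)" by simp
  qed
  \<comment> \<open>Inserting the random origin index preserves measurability because it takes
    countably many values.\<close>
  have F': "(\<lambda>p. F (origin_index (fst (fst p))) p) \<in> borel_measurable (?S \<Otimes>\<^sub>M ?T)"
    by (rule measurable_compose_countable[OF F]) measurable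
  have "(\<integral>\<^sup>+\<omega>. (\<Prod>j<n. w1 (E j \<omega>) (mark_e j \<omega>)) * (\<Prod>j<n. w2 (L j \<omega>) (mark_l j \<omega>)) \<partial>M)
      = (\<integral>\<^sup>+\<omega>. \<integral>\<^sup>+\<omega>'. (\<Prod>j<n. w1 (E j \<omega>) (K (Inr (origin \<omega>, j)) \<omega>')) *
          (\<Prod>j<n. w2 (L j \<omega>) (K (pair_label (origin \<omega>) j) \<omega>')) \<partial>M \<partial>M)"
    using nn_integral_indep_set[OF _ _ LE_K_indep F']
    by (simp add: F_def origin_def mark_e_def mark_l_def)
  also have "\<dots> = (\<integral>\<^sup>+\<omega>. (\<Prod>j<n. \<integral>\<^sup>+z. w1 (E j \<omega>) z \<partial>\<nu>) * (\<Prod>j<n. \<integral>\<^sup>+z. w2 (L j \<omega>) z \<partial>\<nu>) \<partial>M)"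
  proof (rule nn_integral_cong_AE)
    show "AE \<omega> in M. (\<integral>\<^sup>+\<omega>'. (\<Prod>j<n. w1 (E j \<omega>) (K (Inr (origin \<omega>, j)) \<omega>')) *
          (\<Prod>j<n. w2 (L j \<omega>) (K (pair_label (origin \<omega>) j) \<omega>')) \<partial>M) =
        (\<Prod>j<n. \<integral>\<^sup>+z. w1 (E j \<omega>) z \<partial>\<nu>) * (\<Prod>j<n. \<integral>\<^sup>+z. w2 (L j \<omega>) z \<partial>\<nu>)"
      using L_enum
    proof eventually_elim
      case (elim \<omega>)
      then obtain i where "L i \<omega> = 0"
        unfolding bij_betw_def by (metis imageE insertI1)
      then have "L (origin \<omega>) \<omega> = 0"
        unfolding origin_def origin_index_def by (rule LeastI)
      then show ?case
        by (intro nn_integral_prod_marks[where e="\<lambda>j. E j \<omega>" and l="\<lambda>j. L j \<omega>"] w1 w2 w2_0)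
    qed
  qed
  finally show ?thesis .
qed

text \<open>The marking theorem for two processes at once. After averaging, the weights depend on
  positions only, and the limit of their product is a functional of the random sets, whose law is
  known.\<close>

lemma nn_integral_mark_limits:
  fixes w1 w2 :: "plane \<Rightarrow> real \<Rightarrow> real"
  assumes w1 [measurable]: "(\<lambda>p. w1 (fst p) (snd p)) \<in> borel_measurable (borel \<Otimes>\<^sub>M borel)"
    and w2 [measurable]: "(\<lambda>p. w2 (fst p) (snd p)) \<in> borel_measurable (borel \<Otimes>\<^sub>M borel)"
    and w2_0: "\<And>z. w2 0 z = 1"
    and w1_b: "\<And>x z. 0 \<le> w1 x z" "\<And>x z. w1 x z \<le> 1"
    and w2_b: "\<And>x z. 0 \<le> w2 x z" "\<And>x z. w2 x z \<le> 1"
    and A: "\<And>\<omega>. \<omega> \<in> space M \<Longrightarrow> (\<lambda>n. \<Prod>j<n. w1 (E j \<omega>) (mark_e j \<omega>)) \<longlonglongrightarrow> A \<omega>"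
    and B: "\<And>\<omega>. \<omega> \<in> space M \<Longrightarrow> (\<lambda>n. \<Prod>j<n. w2 (L j \<omega>) (mark_l j \<omega>)) \<longlonglongrightarrow> B \<omega>"
  shows "(\<integral>\<^sup>+\<omega>. ennreal (A \<omega> * B \<omega>) \<partial>M) =
    ennreal (exp_neg (ennreal lam_e * (\<integral>\<^sup>+x. ennreal (1 - (\<integral>z. w1 x z \<partial>\<nu>)) \<partial>lborel)) *
             exp_neg (ennreal lam_l * (\<integral>\<^sup>+x. ennreal (1 - (\<integral>z. w2 x z \<partial>\<nu>)) \<partial>lborel)))"
proof -
  define h1 where "h1 x = (\<integral>z. w1 x z \<partial>\<nu>)" for x
  define h2 where "h2 x = (\<integral>z. w2 x z \<partial>\<nu>)" for x
  have w1': "(\<lambda>(x, z). w1 x z) \<in> borel_measurable (borel \<Otimes>\<^sub>M \<nu>)"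
    and w2': "(\<lambda>(x, z). w2 x z) \<in> borel_measurable (borel \<Otimes>\<^sub>M \<nu>)"
    using w1 w2 by (simp_all add: case_prod_beta' cong: measurable_cong_sets sets_pair_measure_cong)
  have h_meas [measurable]: "h1 \<in> borel_measurable borel" "h2 \<in> borel_measurable borel"
    unfolding h1_def[abs_def] h2_def[abs_def]
    using mark.borel_measurable_lebesgue_integral[OF w1'] mark.borel_measurable_lebesgue_integral[OF w2']
    by auto
  have [measurable]: "w1 x \<in> borel_measurable borel" "w2 x \<in> borel_measurable borel" for x
    using measurable_compose[OF measurable_Pair1' w1, of x] measurable_compose[OF measurable_Pair1' w2, of x]
    by auto
  have int: "integrable \<nu> (w1 x)" "integrable \<nu> (w2 x)" for x
    using w1_b w2_b by (auto intro!: mark.integrable_const_bound[of _ 1])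
  have h_nn: "(\<integral>\<^sup>+z. ennreal (w1 x z) \<partial>\<nu>) = ennreal (h1 x)" "(\<integral>\<^sup>+z. ennreal (w2 x z) \<partial>\<nu>) = ennreal (h2 x)" for x
    unfolding h1_def h2_def using w1_b w2_b int by (auto intro!: nn_integral_eq_integral)
  have h_b: "0 \<le> h1 x" "h1 x \<le> 1" "0 \<le> h2 x" "h2 x \<le> 1" for x
    unfolding h1_def h2_def using w1_b w2_b int
    by (auto intro!: mark.integral_le_const integral_nonneg_AE)
  have h2_0: "h2 0 = 1" by (simp add: h2_def w2_0 mark.prob_space[simplified])
  \<comment> \<open>An averaged weight may be 0, for instance if every gain from \<open>x\<close>
    exceeds the threshold and the weight above it is 0; the exponent is then \<top>.\<close>
  define u1 where "u1 x = neg_ln (h1 x)" for x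
  define u2 where "u2 x = neg_ln (h2 x)" for x
  have [measurable]: "u1 \<in> borel_measurable borel" "u2 \<in> borel_measurable borel"
    unfolding u1_def[abs_def] u2_def[abs_def] by measurable
  have u2_0: "u2 0 = 0" by (simp add: u2_def h2_0 neg_ln_def)
  have eu: "exp_neg (u1 x) = h1 x" "exp_neg (u2 x) = h2 x" for x
    by (simp_all add: u1_def u2_def h_b)
  let ?a = "\<lambda>n. \<integral>\<^sup>+\<omega>. ennreal ((\<Prod>j<n. w1 (E j \<omega>) (mark_e j \<omega>)) * (\<Prod>j<n. w2 (L j \<omega>) (mark_l j \<omega>))) \<partial>M"
  let ?b = "\<lambda>n. \<integral>\<^sup>+\<omega>. ennreal ((\<Prod>j<n. h1 (E j \<omega>)) * (\<Prod>j<n. h2 (L j \<omega>))) \<partial>M"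
  have ab: "?a n = ?b n" for n
  proof -
    have "?a n = (\<integral>\<^sup>+\<omega>. (\<Prod>j<n. ennreal (w1 (E j \<omega>) (mark_e j \<omega>))) * (\<Prod>j<n. ennreal (w2 (L j \<omega>) (mark_l j \<omega>))) \<partial>M)"
      using w1_b w2_b by (simp add: prod_ennreal prod_nonneg ennreal_mult')
    also have "\<dots> = (\<integral>\<^sup>+\<omega>. (\<Prod>j<n. \<integral>\<^sup>+z. ennreal (w1 (E j \<omega>) z) \<partial>\<nu>) * (\<Prod>j<n. \<integral>\<^sup>+z. ennreal (w2 (L j \<omega>) z) \<partial>\<nu>) \<partial>M)"
      by (rule nn_integral_marks) (simp_all add: w2_0)
    also have "\<dots> = ?b n"
      using h_b by (simp add: h_nn prod_ennreal prod_nonneg ennreal_mult')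
    finally show ?thesis .
  qed
  have meas_w[measurable]: "(\<lambda>\<omega>. w1 (E j \<omega>) (mark_e j \<omega>)) \<in> borel_measurable M"
    "(\<lambda>\<omega>. w2 (L j \<omega>) (mark_l j \<omega>)) \<in> borel_measurable M" for j
    using measurable_compose[OF _ w1, of "\<lambda>\<omega>. (E j \<omega>, mark_e j \<omega>)" M]
      measurable_compose[OF _ w2, of "\<lambda>\<omega>. (L j \<omega>, mark_l j \<omega>)" M] by auto
  have [measurable]: "A \<in> borel_measurable M" "B \<in> borel_measurable M"
    by (rule borel_measurable_LIMSEQ_real[OF A], simp, simp) (rule borel_measurable_LIMSEQ_real[OF B], simp, simp)
  have a_lim: "?a \<longlonglongrightarrow> (\<integral>\<^sup>+\<omega>. ennreal (A \<omega> * B \<omega>) \<partial>M)"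
  proof (rule nn_integral_dominated_convergence[where w="\<lambda>_. 1"])
    show "AE \<omega> in M. ennreal ((\<Prod>j<n. w1 (E j \<omega>) (mark_e j \<omega>)) * (\<Prod>j<n. w2 (L j \<omega>) (mark_l j \<omega>))) \<le> 1" for n
      using w1_b w2_b by (auto intro!: AE_I2 mult_le_one prod_le_1 prod_nonneg)
    show "AE \<omega> in M. (\<lambda>n. ennreal ((\<Prod>j<n. w1 (E j \<omega>) (mark_e j \<omega>)) * (\<Prod>j<n. w2 (L j \<omega>) (mark_l j \<omega>))))
        \<longlonglongrightarrow> ennreal (A \<omega> * B \<omega>)"
      by (intro AE_I2 tendsto_ennrealI tendsto_mult A B)
  qed (simp_all add: emeasure_space_1)
  have \<Phi>[measurable]: "\<Phi>l \<in> measurable M config_space" "\<Phi>e \<in> measurable M config_space"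
    using poisson_l poisson_e unfolding poisson_process_def by auto
  let ?e = "\<lambda>\<omega>. exp_neg (config_sum u1 (\<Phi>e \<omega>))" and ?l = "\<lambda>\<omega>. exp_neg (config_sum u2 (\<Phi>l \<omega>))"
  \<comment> \<open>\<open>L\<close> enumerates the set with the typical node added; since
    \<open>u2 0 = 0\<close>, the sum over that set equals the sum over
    \<open>\<Phi>l\<close>.\<close>
  have b_lim: "?b \<longlonglongrightarrow> (\<integral>\<^sup>+\<omega>. ennreal (?e \<omega> * ?l \<omega>) \<partial>M)"
  proof (rule nn_integral_dominated_convergence[where w="\<lambda>_. 1"])
    show "AE \<omega> in M. ennreal ((\<Prod>j<n. h1 (E j \<omega>)) * (\<Prod>j<n. h2 (L j \<omega>))) \<le> 1" for n
      using h_b by (auto intro!: AE_I2 mult_le_one prod_le_1 prod_nonneg)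
    show "AE \<omega> in M. (\<lambda>n. ennreal ((\<Prod>j<n. h1 (E j \<omega>)) * (\<Prod>j<n. h2 (L j \<omega>)))) \<longlonglongrightarrow> ennreal (?e \<omega> * ?l \<omega>)"
      using L_enum E_enum
    proof eventually_elim
      case (elim \<omega>)
      from tendsto_exp_neg[OF config_sum_bij_betw[OF elim(1), of u2]]
        tendsto_exp_neg[OF config_sum_bij_betw[OF elim(2), of u1]]
      have "(\<lambda>n. \<Prod>j<n. h2 (L j \<omega>)) \<longlonglongrightarrow> ?l \<omega>" "(\<lambda>n. \<Prod>j<n. h1 (E j \<omega>)) \<longlonglongrightarrow> ?e \<omega>"
        by (simp_all add: exp_neg_sum eu config_sum_insert_0[of u2, OF u2_0])
      then show ?case by (intro tendsto_ennrealI tendsto_mult)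
    qed
  qed (simp_all add: emeasure_space_1)
  have lap_e: "expectation ?e = exp_neg (ennreal lam_e * (\<integral>\<^sup>+x. ennreal (1 - h1 x) \<partial>lborel))"
    using laplace_functional[OF poisson_e, of u1] rates
    by (subst integral_eq_nn_integral) (auto simp: eu)
  have lap_l: "expectation ?l = exp_neg (ennreal lam_l * (\<integral>\<^sup>+x. ennreal (1 - h2 x) \<partial>lborel))"
    using laplace_functional[OF poisson_l, of u2] rates
    by (subst integral_eq_nn_integral) (auto simp: eu)
  \<comment> \<open>Independence of the two processes enters here, through functionals of the random
    sets.\<close>
  have ind: "indep_var borel ?l borel ?e"
    using indep_var_compose[OF processes_indep, of "\<lambda>\<phi>. exp_neg (config_sum u2 \<phi>)" borel "\<lambda>\<phi>. exp_neg (config_sum u1 \<phi>)" borel]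
    by (simp add: comp_def)
  have int: "integrable M ?l" "integrable M ?e"
    by (auto intro!: integrable_const_bound[of _ 1])
  have "(\<integral>\<^sup>+\<omega>. ennreal (?e \<omega> * ?l \<omega>) \<partial>M) = ennreal (expectation (\<lambda>\<omega>. ?l \<omega> * ?e \<omega>))"
    using indep_var_integrable[OF ind int] by (subst nn_integral_eq_integral[symmetric]) (auto simp: mult.commute)
  also have "\<dots> = ennreal (expectation ?e * expectation ?l)"
    using indep_var_lebesgue_integral[OF ind int] by (simp add: mult.commute)
  finally have "(\<integral>\<^sup>+\<omega>. ennreal (?e \<omega> * ?l \<omega>) \<partial>M) = ennreal (expectation ?e * expectation ?l)" .
  moreover have "(\<integral>\<^sup>+\<omega>. ennreal (A \<omega> * B \<omega>) \<partial>M) = (\<integral>\<^sup>+\<omega>. ennreal (?e \<omega> * ?l \<omega>) \<partial>M)"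
    using a_lim b_lim unfolding ab by (rule LIMSEQ_unique)
  ultimately show ?thesis
    unfolding lap_e lap_l h1_def h2_def by simp
qed

end

section \<open>Received powers\<close>

text \<open>The default 0 at the origin means that the typical node never beats an eavesdropper of
  positive gain, so its own index needs no special treatment in the race.\<close>

definition link_gain :: "(real \<Rightarrow> real \<Rightarrow> real) \<Rightarrow> plane \<Rightarrow> real \<Rightarrow> real" where
  "link_gain g x z = (if x \<noteq> 0 \<and> 0 < z then g (norm x) z else 0)"

text \<open>With equal noise a positive rate means a larger gain, and since a maximiser exists,
  beating the strongest eavesdropper is the same as beating all of them.\<close>

lemma iS_graph_out_neighbours:
  assumes g_pos: "\<And>r z. 0 < r \<Longrightarrow> 0 < z \<Longrightarrow> 0 < g r z"
    and P: "0 < P" and noise: "0 < noise"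
    and l: "range l = V" and e: "range e = W" and V: "0 \<in> V" and W: "0 \<notin> W"
    and pos: "\<And>x. x \<in> V \<union> W \<Longrightarrow> x \<noteq> 0 \<Longrightarrow> 0 < z 0 x"
    and ml: "\<And>j. l j \<noteq> 0 \<Longrightarrow> ml j = z 0 (l j)" and me: "\<And>j. me j = z 0 (e j)"
    and ex: "\<exists>x. strongest_eavesdropper P g z W 0 x"
  shows "iS_graph P noise noise 0 g z V W `` {0} =
      l ` {j. \<forall>k. link_gain g (e k) (me k) < link_gain g (l j) (ml j)}" (is "?lhs = ?rhs")
    and "\<exists>j. \<forall>k. link_gain g (e k) (me k) \<le> link_gain g (e j) (me j)"
    and "\<And>j. 0 < link_gain g (e j) (me j)"
proof -
  have e_in: "e k \<in> W" "e k \<noteq> 0" for k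
    using e W by (blast, metis rangeI)
  have l_in: "l j \<in> V" for j
    using l by blast
  have z_pos: "0 < z 0 (e k)" "l j \<noteq> 0 \<Longrightarrow> 0 < z 0 (l j)" for j k
    using pos e_in l_in by auto
  have me_gain: "link_gain g (e k) (me k) = g (dist 0 (e k)) (z 0 (e k))" for k
    using z_pos e_in by (simp add: link_gain_def me)
  have ml_gain: "link_gain g (l j) (ml j) = g (dist 0 (l j)) (z 0 (l j))" if "l j \<noteq> 0" for j
    using z_pos that by (simp add: link_gain_def ml)
  show e_pos: "0 < link_gain g (e j) (me j)" for j
    unfolding me_gain using z_pos e_in by (intro g_pos) auto
  have strongest: "strongest_eavesdropper P g z W 0 x \<longleftrightarrow>
      (\<exists>j. x = e j \<and> (\<forall>k. link_gain g (e k) (me k) \<le> link_gain g (e j) (me j)))" for x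
    unfolding strongest_eavesdropper_iff[OF P] is_arg_max_linorder me_gain e[symmetric] by auto
  show "\<exists>j. \<forall>k. link_gain g (e k) (me k) \<le> link_gain g (e j) (me j)"
    using ex unfolding strongest by blast
  then obtain m where m: "\<And>k. link_gain g (e k) (me k) \<le> link_gain g (e m) (me m)"
    by blast
  have edge: "(\<exists>x. strongest_eavesdropper P g z W 0 x \<and> 0 < secrecy_rate P noise noise g z 0 (l j) x) \<longleftrightarrow>
      (\<forall>k. link_gain g (e k) (me k) < link_gain g (l j) (ml j))" if "l j \<noteq> 0" for j
  proof -
    have "0 < g (dist 0 (l j)) (z 0 (l j))"
      using z_pos that by (intro g_pos) auto
    moreover have "0 < g (dist 0 (e k)) (z 0 (e k))" for k
      using e_pos[of k] unfolding me_gain .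
    ultimately have "0 < secrecy_rate P noise noise g z 0 (l j) (e k) \<longleftrightarrow>
        link_gain g (e k) (me k) < link_gain g (l j) (ml j)" for k
      unfolding me_gain ml_gain[OF that] by (rule secrecy_rate_pos_iff[OF P noise])
    note rate = this
    show ?thesis
    proof
      assume "\<exists>x. strongest_eavesdropper P g z W 0 x \<and> 0 < secrecy_rate P noise noise g z 0 (l j) x"
      then obtain i where "\<And>k. link_gain g (e k) (me k) \<le> link_gain g (e i) (me i)"
        "0 < secrecy_rate P noise noise g z 0 (l j) (e i)"
        unfolding strongest by blast
      then show "\<forall>k. link_gain g (e k) (me k) < link_gain g (l j) (ml j)"
        unfolding rate using le_less_trans by blast
    next
      assume "\<forall>k. link_gain g (e k) (me k) < link_gain g (l j) (ml j)"
      then have "0 < secrecy_rate P noise noise g z 0 (l j) (e m)"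
        unfolding rate by blast
      then show "\<exists>x. strongest_eavesdropper P g z W 0 x \<and> 0 < secrecy_rate P noise noise g z 0 (l j) x"
        unfolding strongest using m by blast
    qed
  qed
  \<comment> \<open>This matches the condition \<open>x \<noteq> y\<close> on edges: the index of
    the typical node drops out by itself.\<close>
  have zero: "\<not> (\<forall>k. link_gain g (e k) (me k) < link_gain g (l j) (ml j))" if "l j = 0" for j
  proof -
    have "link_gain g (l j) (ml j) = 0" using that by (simp add: link_gain_def)
    then show ?thesis using e_pos[of m] by (metis less_asym)
  qed
  have "y \<in> ?lhs \<longleftrightarrow> y \<in> ?rhs" for y
  proof -
    have "y \<in> ?lhs \<longleftrightarrow> (\<exists>j. y = l j \<and> l j \<noteq> 0 \<and>
        (\<exists>x. strongest_eavesdropper P g z W 0 x \<and> 0 < secrecy_rate P noise noise g z 0 (l j) x))"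
      using V l by (auto simp: iS_graph_def)
    also have "\<dots> \<longleftrightarrow> (\<exists>j. y = l j \<and> (\<forall>k. link_gain g (e k) (me k) < link_gain g (l j) (ml j)))"
      using edge zero by blast
    finally show ?thesis by auto
  qed
  then show "?lhs = ?rhs" by blast
qed

text \<open>Measurability is given only in \<open>z\<close> at each fixed distance. Joint
  measurability comes from a countable union: a gain exceeds \<open>y \<ge> 0\<close> iff
  \<open>y < g q z\<close> for some rational \<open>q\<close> beyond the distance, by continuity one
  way and monotonicity the other.\<close>

lemma measurable_link_gain:
  assumes g_meas: "\<And>r. 0 < r \<Longrightarrow> g r \<in> borel_measurable (restrict_space borel {0<..})"
    and g_pos: "\<And>r z. 0 < r \<Longrightarrow> 0 < z \<Longrightarrow> 0 < g r z"
    and g_cont: "\<And>z. 0 < z \<Longrightarrow> continuous_on {0<..} (\<lambda>r. g r z)"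
    and g_anti: "\<And>z. 0 < z \<Longrightarrow> strict_antimono_on {0<..} (\<lambda>r. g r z)"
  shows "(\<lambda>p. link_gain g (fst p) (snd p)) \<in> borel_measurable (borel \<Otimes>\<^sub>M borel)"
proof (rule borel_measurableI_greater)
  fix y :: real
  let ?Q = "\<rat> \<inter> {0<..} :: real set"
  define S where "S q = {z. 0 < z \<and> y < g q z}" for q
  have S[measurable]: "S q \<in> sets borel" if "0 < q" for q
  proof -
    have "{z \<in> space (restrict_space borel {0<..}). y < g q z} \<in> sets (restrict_space borel {0<..})"
      using g_meas[OF that] by measurable
    then show ?thesis
      by (subst (asm) sets_restrict_space_iff) (auto simp: S_def space_restrict_space)
  qed
  show "{p \<in> space (borel \<Otimes>\<^sub>M borel). y < link_gain g (fst p) (snd p)} \<in> sets (borel \<Otimes>\<^sub>M borel)"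
  proof (cases "y < 0")
    case True
    have "0 \<le> link_gain g x z" for x z
      using g_pos by (auto simp: link_gain_def intro: less_imp_le)
    then have "{p \<in> space (borel \<Otimes>\<^sub>M borel). y < link_gain g (fst p) (snd p)} = space (borel \<Otimes>\<^sub>M borel)"
      using True by (auto intro: less_le_trans)
    then show ?thesis by simp
  next
    case False
    have "{p \<in> space (borel \<Otimes>\<^sub>M borel). y < link_gain g (fst p) (snd p)} =
        (\<Union>q\<in>?Q. (ball 0 q - {0}) \<times> S q)"
    proof (intro equalityI subsetI)
      fix p :: "plane \<times> real"
      assume "p \<in> {p \<in> space (borel \<Otimes>\<^sub>M borel). y < link_gain g (fst p) (snd p)}"
      then obtain x z where p: "p = (x, z)" and xz: "x \<noteq> 0" "0 < z" "y < g (norm x) z"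
        using False by (cases p) (auto simp: link_gain_def split: if_splits)
      have "isCont (\<lambda>r. g r z) (norm x)"
        using g_cont[OF xz(2)] xz(1) by (simp add: continuous_on_eq_continuous_at)
      then have "((\<lambda>r. g r z) \<longlongrightarrow> g (norm x) z) (at_right (norm x))"
        unfolding isCont_def by (rule filterlim_mono) (auto simp: at_within_le_at)
      then have "eventually (\<lambda>r. y < g r z) (at_right (norm x))"
        using xz(3) by (rule order_tendstoD)
      then obtain b where b: "norm x < b" "\<And>r. norm x < r \<Longrightarrow> r < b \<Longrightarrow> y < g r z"
        unfolding eventually_at_right_field by blast
      obtain q where q: "q \<in> \<rat>" "norm x < q" "q < b"
        using Rats_dense_in_real[OF b(1)] by blast
      then have "0 < q" using norm_ge_zero[of x] by linarith
      then show "p \<in> (\<Union>q\<in>?Q. (ball 0 q - {0}) \<times> S q)"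
        using q b xz by (auto simp: p S_def)
    next
      fix p :: "plane \<times> real"
      assume "p \<in> (\<Union>q\<in>?Q. (ball 0 q - {0}) \<times> S q)"
      then obtain q where q: "0 < q" "p \<in> (ball 0 q - {0}) \<times> S q"
        by blast
      obtain x z where p: "p = (x, z)" by (cases p)
      have *: "0 < q" "norm x < q" "x \<noteq> 0" "0 < z" "y < g q z"
        using q by (auto simp: p S_def)
      have "g q z < g (norm x) z"
        using g_anti[OF *(4)] * by (auto simp: monotone_on_def)
      then show "p \<in> {p \<in> space (borel \<Otimes>\<^sub>M borel). y < link_gain g (fst p) (snd p)}"
        using * by (auto simp: p link_gain_def space_pair_measure)
    qed
    also have "\<dots> \<in> sets (borel \<Otimes>\<^sub>M borel)"
    proof (rule sets.countable_UN'')
      show "countable ?Q" by (intro countable_Int1 countable_rat)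
      show "(ball 0 q - {0}) \<times> S q \<in> sets (borel \<Otimes>\<^sub>M borel)" if "q \<in> ?Q" for q
        using S[of q] that by (intro pair_measureI) auto
    qed
    finally show ?thesis .
  qed
qed

text \<open>Strict monotonicity allows at most one distance for each level, and \<open>t > 0\<close>
  excludes the points with the default gain 0.\<close>

lemma link_gain_level_set:
  assumes g_anti: "\<And>z. 0 < z \<Longrightarrow> strict_antimono_on {0<..} (\<lambda>r. g r z)" and t: "0 < t"
  shows "\<exists>r. {x. link_gain g x z = t} \<subseteq> sphere 0 r"
proof (cases "\<exists>r>0. 0 < z \<and> g r z = t")
  case True
  then obtain r where r: "0 < r" "0 < z" "g r z = t" by blast
  have "norm x = r" if "link_gain g x z = t" for x
  proof (rule ccontr)
    assume "norm x \<noteq> r"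
    moreover have "x \<noteq> 0" "g (norm x) z = t"
      using that t by (auto simp: link_gain_def split: if_splits)
    ultimately show False
      using g_anti[OF r(2)] r by (cases "norm x" r rule: linorder_cases) (force simp: monotone_on_def)+
  qed
  then show ?thesis by (intro exI[of _ r]) auto
next
  case False
  then have "{x. link_gain g x z = t} = {}"
    using t by (auto simp: link_gain_def split: if_splits)
  then show ?thesis by auto
qed

lemma measure_lborel_sphere: "measure lborel (sphere (a :: plane) r) = 0"
proof -
  have "sphere a r \<in> null_sets lebesgue"
    using negligible_sphere[of a r] by (simp add: negligible_iff_null_sets)
  then have "emeasure lborel (sphere a r) = 0"
    by (simp add: null_sets_def)
  then show ?thesis by (simp add: measure_def)
qed

section \<open>The gains seen from the typical node as a Poisson race\<close>

locale secrecy_links = marked_poisson M L E K \<nu> \<Phi>l \<Phi>e lam_l lam_e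
  for M :: "'w measure" and L E K \<nu> \<Phi>l \<Phi>e lam_l lam_e +
  fixes g :: "real \<Rightarrow> real \<Rightarrow> real"
  assumes gain_measurable [measurable]:
      "(\<lambda>p. link_gain g (fst p) (snd p)) \<in> borel_measurable (borel \<Otimes>\<^sub>M borel)"
    and gain_level_set: "\<And>t z. 0 < t \<Longrightarrow> \<exists>r. {x. link_gain g x z = t} \<subseteq> sphere 0 r"
begin

definition gain_e :: "nat \<Rightarrow> 'w \<Rightarrow> real" where
  "gain_e j \<omega> = link_gain g (E j \<omega>) (mark_e j \<omega>)"

definition gain_l :: "nat \<Rightarrow> 'w \<Rightarrow> real" where
  "gain_l j \<omega> = link_gain g (L j \<omega>) (mark_l j \<omega>)"

text \<open>This becomes the \<open>G\<close> of \<open>poisson_race\<close>. It may be \<top>, as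
  no moment condition on the marks is imposed.\<close>

definition mean_above :: "real \<Rightarrow> ennreal" where
  "mean_above t = (\<integral>\<^sup>+x. ennreal (measure \<nu> {z. t < link_gain g x z}) \<partial>lborel)"

text \<open>Taking the least maximising index makes this a composition with a measurable index of
  countable range. It is the maximum only where a maximum exists.\<close>

definition best_e :: "'w \<Rightarrow> real" where
  "best_e \<omega> = gain_e (LEAST j. \<forall>k. gain_e k \<omega> \<le> gain_e j \<omega>) \<omega>"

lemma measurable_gain_e [measurable]: "gain_e j \<in> borel_measurable M"
  using measurable_compose[OF _ gain_measurable, of "\<lambda>\<omega>. (E j \<omega>, mark_e j \<omega>)" M]
  by (simp add: gain_e_def[abs_def])

lemma measurable_gain_l [measurable]: "gain_l j \<in> borel_measurable M"
  using measurable_compose[OF _ gain_measurable, of "\<lambda>\<omega>. (L j \<omega>, mark_l j \<omega>)" M]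
  by (simp add: gain_l_def[abs_def])

lemma measurable_best_e [measurable]: "best_e \<in> borel_measurable M"
  unfolding best_e_def[abs_def] by (rule measurable_compose_countable) measurable

lemma measurable_gain_section [measurable]: "link_gain g x \<in> borel_measurable borel"
  using measurable_compose[OF measurable_Pair1' gain_measurable, of x] by simp

lemma best_e_eq:
  assumes "\<exists>j. \<forall>k. gain_e k \<omega> \<le> gain_e j \<omega>"
  shows "\<exists>j. best_e \<omega> = gain_e j \<omega>" "gain_e k \<omega> \<le> best_e \<omega>"
  using LeastI_ex[OF assms] by (auto simp: best_e_def)

lemma best_e_le_iff: "\<exists>j. \<forall>k. gain_e k \<omega> \<le> gain_e j \<omega> \<Longrightarrow> best_e \<omega> \<le> t \<longleftrightarrow> (\<forall>k. gain_e k \<omega> \<le> t)"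
  using best_e_eq by (metis order_trans)

lemma best_e_less_iff: "\<exists>j. \<forall>k. gain_e k \<omega> \<le> gain_e j \<omega> \<Longrightarrow> best_e \<omega> < t \<longleftrightarrow> (\<forall>k. gain_e k \<omega> < t)"
  using best_e_eq by (metis le_less_trans)

text \<open>The multiplicative weight whose product over the points is \<open>c\<close> to the
  number of gains above \<open>t\<close>.\<close>

definition damp :: "real \<Rightarrow> real \<Rightarrow> plane \<Rightarrow> real \<Rightarrow> real" where
  "damp c t x z = (if t < link_gain g x z then c else 1)"

lemma measurable_damp: "(\<lambda>p. damp c t (fst p) (snd p)) \<in> borel_measurable (borel \<Otimes>\<^sub>M borel)"
  unfolding damp_def by measurable

lemma nn_integral_damp:
  assumes c: "0 \<le> c" "c \<le> 1"
  shows "(\<integral>\<^sup>+x. ennreal (1 - (\<integral>z. damp c t x z \<partial>\<nu>)) \<partial>lborel) = ennreal (1 - c) * mean_above t"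
proof -
  have m: "(\<lambda>x. measure \<nu> {z. t < link_gain g x z}) \<in> borel_measurable borel"
  proof -
    have "(\<lambda>(x, z). indicator {z. t < link_gain g x z} z :: real) \<in> borel_measurable (borel \<Otimes>\<^sub>M \<nu>)"
      by (simp add: case_prod_beta' indicator_def cong: measurable_cong_sets sets_pair_measure_cong)
    from mark.borel_measurable_lebesgue_integral[OF this] show ?thesis by simp
  qed
  have "1 - (\<integral>z. damp c t x z \<partial>\<nu>) = (1 - c) * measure \<nu> {z. t < link_gain g x z}" for x
  proof -
    have int: "integrable \<nu> (indicator {z. t < link_gain g x z} :: real \<Rightarrow> real)"
      by (rule mark.integrable_const_bound[of _ 1]) (auto simp: indicator_def)
    have "(\<integral>z. damp c t x z \<partial>\<nu>) = (\<integral>z. 1 - (1 - c) * indicator {z. t < link_gain g x z} z \<partial>\<nu>)"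
      by (intro Bochner_Integration.integral_cong) (auto simp: damp_def indicator_def)
    also have "\<dots> = 1 - (1 - c) * measure \<nu> {z. t < link_gain g x z}"
      using mark.prob_space int by (subst Bochner_Integration.integral_diff) auto
    finally show ?thesis by simp
  qed
  then show ?thesis
    unfolding mean_above_def using c m by (simp add: ennreal_mult' nn_integral_cmult)
qed

text \<open>The condition \<open>0 < t'\<close> gives the typical node, whose gain is 0, the weight
  1 required of the legitimate side; the eavesdropper side has no such requirement.\<close>

lemma nn_integral_card_powers:
  assumes t: "0 < t'" and c: "0 \<le> c" "c < 1" "0 \<le> s" "s < 1"
  shows "(\<integral>\<^sup>+\<omega>. ennreal (card_power c {j. t < gain_e j \<omega>} * card_power s {j. t' < gain_l j \<omega>}) \<partial>M) =
    ennreal (exp_neg (ennreal lam_e * (ennreal (1 - c) * mean_above t)) *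
             exp_neg (ennreal lam_l * (ennreal (1 - s) * mean_above t')))"
proof -
  have A: "(\<lambda>n. \<Prod>j<n. damp c t (E j \<omega>) (mark_e j \<omega>)) \<longlonglongrightarrow> card_power c {j. t < gain_e j \<omega>}" for \<omega>
    using tendsto_card_power[OF c(1,2), of "{j. t < gain_e j \<omega>}"] by (simp add: damp_def gain_e_def)
  have B: "(\<lambda>n. \<Prod>j<n. damp s t' (L j \<omega>) (mark_l j \<omega>)) \<longlonglongrightarrow> card_power s {j. t' < gain_l j \<omega>}" for \<omega>
    using tendsto_card_power[OF c(3,4), of "{j. t' < gain_l j \<omega>}"] by (simp add: damp_def gain_l_def)
  show ?thesis
    using nn_integral_mark_limits[OF measurable_damp measurable_damp _ _ _ _ _ A B] c t
    by (simp add: nn_integral_damp) (simp add: damp_def link_gain_def)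
qed

lemma nn_integral_card_power_e:
  assumes c: "0 \<le> c" "c < 1"
  shows "(\<integral>\<^sup>+\<omega>. ennreal (card_power c {j. t < gain_e j \<omega>}) \<partial>M) =
    ennreal (exp_neg (ennreal lam_e * (ennreal (1 - c) * mean_above t)))"
proof -
  have A: "(\<lambda>n. \<Prod>j<n. damp c t (E j \<omega>) (mark_e j \<omega>)) \<longlonglongrightarrow> card_power c {j. t < gain_e j \<omega>}" for \<omega>
    using tendsto_card_power[OF c, of "{j. t < gain_e j \<omega>}"] by (simp add: damp_def gain_e_def)
  \<comment> \<open>The legitimate side is switched off by the constant weight 1. Using
    \<open>card_power 1\<close> instead would fail, being 0 on infinite sets.\<close>
  have one: "damp 1 1 x z = 1" for x z by (simp add: damp_def)
  have "(\<integral>\<^sup>+\<omega>. ennreal (card_power c {j. t < gain_e j \<omega>} * 1) \<partial>M) =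
    ennreal (exp_neg (ennreal lam_e * (\<integral>\<^sup>+x. ennreal (1 - (\<integral>z. damp c t x z \<partial>\<nu>)) \<partial>lborel)) *
             exp_neg (ennreal lam_l * (\<integral>\<^sup>+x. ennreal (1 - (\<integral>z. damp 1 1 x z \<partial>\<nu>)) \<partial>lborel)))"
    using c by (intro nn_integral_mark_limits measurable_damp A) (simp_all add: one, simp_all add: damp_def)
  then show ?thesis
    using nn_integral_damp[of c t] nn_integral_damp[of 1 1] c by simp
qed

text \<open>The positions, not the marks, exclude atoms: for a frozen mark the level set lies in a
  sphere, which is Lebesgue null and almost surely contains no eavesdropper.\<close>

lemma gain_e_no_atom:
  assumes t: "0 < t"
  shows "AE \<omega> in M. gain_e j \<omega> \<noteq> t"
proof -
  \<comment> \<open>The origin index is fixed first; the random one is covered afterwards by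
    intersecting over all \<open>i\<close>.\<close>
  have "AE \<omega> in M. link_gain g (E j \<omega>) (K (Inr (i, j)) \<omega>) \<noteq> t" for i
  proof -
    let ?S = "PiM UNIV (\<lambda>_::nat. borel :: plane measure) \<Otimes>\<^sub>M PiM UNIV (\<lambda>_::nat. borel :: plane measure)"
    let ?T = "PiM links (\<lambda>_. borel :: real measure)"
    define F :: "_ \<Rightarrow> ennreal" where
      "F p = indicator {t} (link_gain g (snd (fst p) j) (snd p (Inr (i, j))))"
      for p :: "((nat \<Rightarrow> plane) \<times> (nat \<Rightarrow> plane)) \<times> (nat \<times> nat + nat \<times> nat \<Rightarrow> real)"
    have proj: "(\<lambda>p. snd p k) \<in> borel_measurable (?S \<Otimes>\<^sub>M ?T)" if "k \<in> links" for k
      using that by measurable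
    have "(\<lambda>p. (snd (fst p) j, snd p (Inr (i, j)))) \<in> measurable (?S \<Otimes>\<^sub>M ?T) (borel \<Otimes>\<^sub>M borel)"
      by (intro measurable_Pair proj) auto
    from measurable_compose[OF this gain_measurable]
    have "F \<in> borel_measurable (?S \<Otimes>\<^sub>M ?T)"
      unfolding F_def[abs_def] by (intro borel_measurable_indicator') auto
    note nn_integral_indep_set'[OF _ _ LE_K_indep this]
    then have "(\<integral>\<^sup>+\<omega>. indicator {t} (link_gain g (E j \<omega>) (K (Inr (i, j)) \<omega>)) \<partial>M) =
      (\<integral>\<^sup>+\<omega>'. \<integral>\<^sup>+\<omega>. indicator {t} (link_gain g (E j \<omega>) (K (Inr (i, j)) \<omega>')) \<partial>M \<partial>M)"
      by (simp add: F_def)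
    also have "\<dots> = (\<integral>\<^sup>+\<omega>'. 0 \<partial>M)"
    proof (rule nn_integral_cong)
      fix \<omega>'
      obtain r where r: "{x. link_gain g x (K (Inr (i, j)) \<omega>') = t} \<subseteq> sphere 0 r"
        using gain_level_set[OF t] by blast
      have "AE \<omega> in M. \<Phi>e \<omega> \<inter> sphere 0 r = {}"
        by (rule poisson_process_null_set[OF poisson_e]) (simp_all add: measure_lborel_sphere)
      then have "AE \<omega> in M. indicator {t} (link_gain g (E j \<omega>) (K (Inr (i, j)) \<omega>')) = (0::ennreal)"
        using E_enum
      proof eventually_elim
        case (elim \<omega>)
        then have "E j \<omega> \<notin> sphere 0 r" unfolding bij_betw_def by blast
        then show ?case using r by (auto simp: indicator_def)
      qed
      then show "(\<integral>\<^sup>+\<omega>. indicator {t} (link_gain g (E j \<omega>) (K (Inr (i, j)) \<omega>')) \<partial>M) = 0"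
        by (subst nn_integral_cong_AE) auto
    qed
    finally have "(\<integral>\<^sup>+\<omega>. indicator {t} (link_gain g (E j \<omega>) (K (Inr (i, j)) \<omega>)) \<partial>M) = 0"
      by simp
    moreover have "(\<lambda>\<omega>. link_gain g (E j \<omega>) (K (Inr (i, j)) \<omega>)) \<in> borel_measurable M"
      using measurable_compose[OF _ gain_measurable, of "\<lambda>\<omega>. (E j \<omega>, K (Inr (i, j)) \<omega>)" M] by simp
    ultimately have "AE \<omega> in M. indicator {t} (link_gain g (E j \<omega>) (K (Inr (i, j)) \<omega>)) = (0::ennreal)"
      by (subst (asm) nn_integral_0_iff_AE) auto
    then show ?thesis
      by eventually_elim (auto simp: indicator_def split: if_splits)
  qed
  then have "AE \<omega> in M. \<forall>i. link_gain g (E j \<omega>) (K (Inr (i, j)) \<omega>) \<noteq> t"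
    by (simp add: AE_all_countable)
  then show ?thesis
    by eventually_elim (simp add: gain_e_def mark_e_def)
qed

lemma poisson_race_gains:
  assumes ex: "AE \<omega> in M. \<exists>j. \<forall>k. gain_e k \<omega> \<le> gain_e j \<omega>"
    and pos: "AE \<omega> in M. \<forall>j. 0 < gain_e j \<omega>"
  shows "poisson_race M best_e gain_l mean_above lam_l lam_e"
proof (intro poisson_race.intro poisson_race_axioms.intro)
  show "prob_space M" by unfold_locales
  show best_pos: "AE \<omega> in M. 0 < best_e \<omega>"
    using ex pos by eventually_elim (metis best_e_eq(1))
  show "AE \<omega> in M. best_e \<omega> \<noteq> t" for t
  proof (cases "0 < t")
    case True
    have "AE \<omega> in M. \<forall>j. gain_e j \<omega> \<noteq> t"
      using gain_e_no_atom[OF True] by (simp add: AE_all_countable)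
    then show ?thesis using ex by eventually_elim (metis best_e_eq(1))
  next
    \<comment> \<open>Nonpositive levels are excluded by positivity of the best gain.\<close>
    case False
    then show ?thesis using best_pos by (auto elim!: eventually_mono)
  qed
  \<comment> \<open>The void event of the eavesdropper gains above \<open>t\<close> is the event
    that the best one is at most \<open>t\<close>, so both remaining laws are cases of the formulas
    for \<open>card_power\<close>.\<close>
  have ind: "AE \<omega> in M. card_power 0 {j. t < gain_e j \<omega>} = indicator {\<omega> \<in> space M. best_e \<omega> \<le> t} \<omega>" for t
    using ex AE_space
  proof eventually_elim
    case (elim \<omega>)
    have "card_power 0 J = (if J = {} then 1 else 0)" for J
      by (auto simp: card_power_def power_0_left)
    moreover have "{j. t < gain_e j \<omega>} = {} \<longleftrightarrow> best_e \<omega> \<le> t"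
      using best_e_le_iff[OF elim(1), of t] by (auto simp: not_less)
    ultimately show ?case
      using elim(2) by (simp add: indicator_def)
  qed
  show "prob {\<omega> \<in> space M. best_e \<omega> \<le> t} = exp_neg (ennreal lam_e * mean_above t)" for t
  proof -
    have "ennreal (exp_neg (ennreal lam_e * mean_above t)) =
        (\<integral>\<^sup>+\<omega>. ennreal (card_power 0 {j. t < gain_e j \<omega>}) \<partial>M)"
      by (simp add: nn_integral_card_power_e)
    also have "\<dots> = (\<integral>\<^sup>+\<omega>. indicator {\<omega> \<in> space M. best_e \<omega> \<le> t} \<omega> \<partial>M)"
      using ind[of t] by (intro nn_integral_cong_AE) (auto simp: indicator_def)
    also have "\<dots> = ennreal (prob {\<omega> \<in> space M. best_e \<omega> \<le> t})"
      by (simp add: emeasure_eq_measure)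
    finally show ?thesis by simp
  qed
  show "expectation (\<lambda>\<omega>. indicator {\<omega> \<in> space M. best_e \<omega> \<le> t} \<omega> * card_power s {j. t' < gain_l j \<omega>}) =
      exp_neg (ennreal lam_e * mean_above t) * exp_neg (ennreal ((1 - s) * lam_l) * mean_above t')"
    if t: "0 < t" "0 < t'" and s: "0 < s" "s < 1" for t t' s
  proof -
    have [measurable]: "(\<lambda>\<omega>. card_power s {j. t' < gain_l j \<omega>}) \<in> borel_measurable M"
    proof (rule borel_measurable_LIMSEQ_real[OF tendsto_card_power])
      show "(\<lambda>\<omega>. \<Prod>j<n. if j \<in> {j. t' < gain_l j \<omega>} then s else 1) \<in> borel_measurable M" for n
        by simp
    qed (use s in auto)
    have "ennreal (exp_neg (ennreal lam_e * mean_above t) * exp_neg (ennreal ((1 - s) * lam_l) * mean_above t')) =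
        (\<integral>\<^sup>+\<omega>. ennreal (card_power 0 {j. t < gain_e j \<omega>} * card_power s {j. t' < gain_l j \<omega>}) \<partial>M)"
      using s t rates by (subst nn_integral_card_powers) (simp_all add: ennreal_mult' mult_ac)
    also have "\<dots> = (\<integral>\<^sup>+\<omega>. ennreal (indicator {\<omega> \<in> space M. best_e \<omega> \<le> t} \<omega> * card_power s {j. t' < gain_l j \<omega>}) \<partial>M)"
      using ind[of t] by (intro nn_integral_cong_AE) auto
    finally have eq: "(\<integral>\<^sup>+\<omega>. ennreal (indicator {\<omega> \<in> space M. best_e \<omega> \<le> t} \<omega> * card_power s {j. t' < gain_l j \<omega>}) \<partial>M) =
      ennreal (exp_neg (ennreal lam_e * mean_above t) * exp_neg (ennreal ((1 - s) * lam_l) * mean_above t'))"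
      by (rule sym)
    show ?thesis
      using s card_power_bounds[of s]
      by (subst integral_eq_nn_integral) (auto intro!: AE_I2 simp only: eq enn2real_ennreal, auto)
  qed
qed (use rates in auto)

end

text \<open>\<open>S\<close> arises from a measurable set by removing and adding subsets of a null
  set. This suits the out-degree event, as \<open>Z\<close> is controlled only along the
  enumerations.\<close>

lemma measure_completion_AE_eq:
  assumes S': "S' \<in> sets M" and S: "S \<subseteq> space M" and ae: "AE \<omega> in M. \<omega> \<in> S \<longleftrightarrow> \<omega> \<in> S'"
  shows "measure (completion M) S = measure M S'"
proof -
  have "AE \<omega> in M. \<not> (\<omega> \<in> S - S' \<or> \<omega> \<in> S' - S)"
    using ae by eventually_elim auto
  then obtain N where N: "N \<in> null_sets M" "{\<omega> \<in> space M. \<omega> \<in> S - S' \<or> \<omega> \<in> S' - S} \<subseteq> N"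
    by (rule AE_E) (use that in \<open>auto simp: null_sets_def\<close>)
  have "S' \<subseteq> space M" using S' by (rule sets.sets_into_space)
  then have "S - S' \<subseteq> N" "S' - S \<subseteq> N" using N(2) S by auto
  then have null: "S - S' \<in> null_sets (completion M)" "S' - S \<in> null_sets (completion M)"
    using N(1) by (auto simp: null_sets_completion_iff2)
  have "(S' - (S' - S)) \<union> (S - S') \<in> sets (completion M)"
    by (intro sets.Un sets.Diff null_setsD2 null sets_completionI_sets S')
  also have "(S' - (S' - S)) \<union> (S - S') = S" by blast
  finally have "S \<in> sets (completion M)" .
  then have "measure (completion M) S = measure (completion M) S'"
    using S' ae by (intro measure_eq_AE AE_completion) auto
  then show ?thesis using S' by simp
qed

theorem theorem3p3:
  fixes M :: "'w measure"
    and \<Phi>l \<Phi>e :: "'w \<Rightarrow> (real ^ 2) set"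
    and Z :: "'w \<Rightarrow> real ^ 2 \<Rightarrow> real ^ 2 \<Rightarrow> real"
    and g :: "real \<Rightarrow> real \<Rightarrow> real"
    and f :: "real \<Rightarrow> real"
    and lam_l lam_e P noise :: real
    and n :: nat
  assumes "prob_space M"
    and "0 < lam_l" and "0 < lam_e"
    and "poisson_process M lam_l \<Phi>l" and "poisson_process M lam_e \<Phi>e"
    and "prob_space.indep_var M config_space \<Phi>l config_space \<Phi>e"
    and "continuous_on {0<..} f" and "\<And>z. 0 \<le> f z"
    and "iid_propagation M (\<lambda>\<omega>. insert 0 (\<Phi>l \<omega>)) \<Phi>e f Z"
    and "\<And>r z. 0 < r \<Longrightarrow> 0 < z \<Longrightarrow> 0 < g r z"
    and "\<And>r. 0 < r \<Longrightarrow> g r \<in> borel_measurable (restrict_space borel {0<..})"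
    and "\<And>z. 0 < z \<Longrightarrow> continuous_on {0<..} (\<lambda>r. g r z)"
    and "\<And>z. 0 < z \<Longrightarrow> strict_antimono_on {0<..} (\<lambda>r. g r z)"
    and "\<And>z. 0 < z \<Longrightarrow> ((\<lambda>r. g r z) \<longlongrightarrow> 0) at_top"
    and "0 < P" and "0 < noise"
    and "AE \<omega> in M. \<forall>x \<in> insert 0 (\<Phi>l \<omega>). \<exists>e. strongest_eavesdropper P g (Z \<omega>) (\<Phi>e \<omega>) x e"
  shows "measure (completion M)
           {\<omega> \<in> space M.
              out_degree (iS_graph P noise noise 0 g (Z \<omega>) (insert 0 (\<Phi>l \<omega>)) (\<Phi>e \<omega>)) 0 = enat n} =
         (lam_l / (lam_l + lam_e)) ^ n * (lam_e / (lam_l + lam_e))"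
proof -
  interpret prob_space M by fact
  note g_pos = assms(10) and g_meas = assms(11) and g_cont = assms(12) and g_anti = assms(13)
  \<comment> \<open>The goal is proved for fixed enumerations first, so that the locale can be
    interpreted for them; the existential is eliminated at the end.\<close>
  have ?thesis if Z_ae: "AE \<omega> in M. \<forall>u \<in> insert 0 (\<Phi>l \<omega>). \<forall>v \<in> insert 0 (\<Phi>l \<omega>) \<union> \<Phi>e \<omega>.
        u \<noteq> v \<longrightarrow> Z \<omega> u v = Z \<omega> v u \<and> 0 < Z \<omega> u v"
    and LE: "\<forall>i. L i \<in> borel_measurable M" "\<forall>j. E j \<in> borel_measurable M"
    and bij: "AE \<omega> in M. bij_betw (\<lambda>i. L i \<omega>) UNIV (insert 0 (\<Phi>l \<omega>)) \<and> bij_betw (\<lambda>j. E j \<omega>) UNIV (\<Phi>e \<omega>)"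
    and distr: "\<forall>k\<in>links. distributed M lborel (link_effect Z L E k) (\<lambda>z. ennreal (f z))"
    and indep: "indep_vars (\<lambda>_. borel) (link_effect Z L E) links"
      "indep_set
          (sets (vimage_algebra (space M) (\<lambda>\<omega>. ((\<lambda>i. L i \<omega>), (\<lambda>j. E j \<omega>)))
             (PiM UNIV (\<lambda>_. borel) \<Otimes>\<^sub>M PiM UNIV (\<lambda>_. borel))))
          (sets (vimage_algebra (space M) (\<lambda>\<omega>. \<lambda>k\<in>links. link_effect Z L E k \<omega>)
             (PiM links (\<lambda>_. borel))))" for L E
  proof -
    interpret secrecy_links M L E "link_effect Z L E" "density lborel (\<lambda>z. ennreal (f z))" \<Phi>l \<Phi>e lam_l lam_e g
    proof
      show "link_effect Z L E k \<in> borel_measurable M" if "k \<in> links" for k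
        using distributed_measurable[OF distr[rule_format, OF that]] by simp
      show "distr M lborel (link_effect Z L E k) = density lborel (\<lambda>z. ennreal (f z))" if "k \<in> links" for k
        using distributed_distr_eq_density[OF distr[rule_format, OF that]] .
      show "(\<lambda>p. link_gain g (fst p) (snd p)) \<in> borel_measurable (borel \<Otimes>\<^sub>M borel)"
        by (rule measurable_link_gain[OF g_meas g_pos g_cont g_anti])
      show "\<exists>r. {x. link_gain g x z = t} \<subseteq> sphere 0 r" if "0 < t" for t z
        by (rule link_gain_level_set[OF g_anti that])
    qed (use assms LE bij indep in auto)
    \<comment> \<open>An eavesdropper at the origin would be at distance 0, where \<open>g\<close>
      is not assumed positive.\<close>
    have "AE \<omega> in M. \<Phi>e \<omega> \<inter> {0} = {}"
      by (rule poisson_process_null_set[OF assms(5)]) auto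
    then have good: "AE \<omega> in M. (\<exists>j. \<forall>k. gain_e k \<omega> \<le> gain_e j \<omega>) \<and> (\<forall>j. 0 < gain_e j \<omega>) \<and>
        (out_degree (iS_graph P noise noise 0 g (Z \<omega>) (insert 0 (\<Phi>l \<omega>)) (\<Phi>e \<omega>)) 0 = enat n \<longleftrightarrow>
          finite {j. best_e \<omega> < gain_l j \<omega>} \<and> card {j. best_e \<omega> < gain_l j \<omega>} = n)"
      using bij Z_ae assms(17)
    proof eventually_elim
      case (elim \<omega>)
      let ?V = "insert 0 (\<Phi>l \<omega>)" and ?W = "\<Phi>e \<omega>"
      have L: "inj (\<lambda>i. L i \<omega>)" "range (\<lambda>i. L i \<omega>) = ?V" and E: "range (\<lambda>j. E j \<omega>) = ?W"
        using elim(2) by (auto simp: bij_betw_def)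
      have Z: "Z \<omega> u v = Z \<omega> v u" "0 < Z \<omega> u v" if "u \<in> ?V" "v \<in> ?V \<union> ?W" "u \<noteq> v" for u v
        using elim(3) that by blast+
      have L_in: "L j \<omega> \<in> ?V" for j using L(2) by blast
      obtain i where "L i \<omega> = 0" using L(2) by (metis imageE insertI1)
      then have origin: "L (origin \<omega>) \<omega> = 0"
        unfolding origin_def origin_index_def by (rule LeastI)
      \<comment> \<open>Labels list the smaller index first, so the variable may be \<open>Z\<close>
        from \<open>L j\<close> to the origin; symmetry of \<open>Z\<close> turns it around.\<close>
      have ml: "mark_l j \<omega> = Z \<omega> 0 (L j \<omega>)" if "L j \<omega> \<noteq> 0" for j
      proof -
        have "origin \<omega> \<noteq> j" using that origin by auto
        moreover have "Z \<omega> (L j \<omega>) 0 = Z \<omega> 0 (L j \<omega>)"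
          using Z(1)[of 0 "L j \<omega>"] L_in[of j] that by auto
        ultimately show ?thesis
          using origin by (auto simp: mark_l_def pair_label_def link_effect_def min_def max_def)
      qed
      have me: "mark_e j \<omega> = Z \<omega> 0 (E j \<omega>)" for j
        using origin by (simp add: mark_e_def link_effect_def)
      have pos: "0 < Z \<omega> 0 x" if "x \<in> ?V \<union> ?W" "x \<noteq> 0" for x
        using Z(2)[of 0 x] that by auto
      have "0 \<in> ?V" "0 \<notin> ?W" "\<exists>x. strongest_eavesdropper P g (Z \<omega>) ?W 0 x"
        using elim by auto
      note out = iS_graph_out_neighbours[where g = g, OF g_pos assms(15,16) L(2) E this(1,2) pos ml me this(3)]
      have ex: "\<exists>j. \<forall>k. gain_e k \<omega> \<le> gain_e j \<omega>" and gpos: "\<forall>j. 0 < gain_e j \<omega>"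
        using out(2,3) by (simp_all add: gain_e_def)
      have "iS_graph P noise noise 0 g (Z \<omega>) ?V ?W `` {0} = (\<lambda>j. L j \<omega>) ` {j. best_e \<omega> < gain_l j \<omega>}"
        using out(1) by (simp add: best_e_less_iff[OF ex] gain_e_def gain_l_def)
      moreover have "inj_on (\<lambda>j. L j \<omega>) A" for A using L(1) by (rule inj_on_subset) simp
      ultimately show ?case
        using ex gpos by (simp add: out_degree_def finite_image_iff card_image)
    qed
    interpret race: poisson_race M best_e gain_l mean_above lam_l lam_e
      using good by (intro poisson_race_gains) (auto elim!: eventually_mono)
    have "measure (completion M)
             {\<omega> \<in> space M.
                out_degree (iS_graph P noise noise 0 g (Z \<omega>) (insert 0 (\<Phi>l \<omega>)) (\<Phi>e \<omega>)) 0 = enat n} =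
        prob {\<omega> \<in> space M. finite {j. best_e \<omega> < gain_l j \<omega>} \<and> card {j. best_e \<omega> < gain_l j \<omega>} = n}"
      using good by (intro measure_completion_AE_eq race.sets_card_winners) (auto elim!: eventually_mono)
    then show ?thesis
      by (simp add: race.prob_card_winners)
  qed
  then show ?thesis
    using assms(9) unfolding iid_propagation_def by (elim conjE exE)
qed

end
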